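(* For the speed-scaled Euclidean TSPD model with drone speed factor $\alpha\ge1$, and every $h>0$, $$\beta_{\mathsf{TSPD}}\le\frac{1}{2h}\,\mathbb{E}\left[\max\Big\{L_{02},\tfrac1\alpha(L_{01}+L_{12})\Big\}\right],$$ where $Z_1,Z_2$ are $\mathrm{Exponential}(1)$, $U_0,U_1,U_2$ are $\mathrm{Uniform}[0,1]$, all independent, and $L_{01}=\sqrt{Z_1^2+h^4(U_0-U_1)^2}$, $L_{12}=\sqrt{Z_2^2+h^4(U_1-U_2)^2}$, $L_{02}=\sqrt{(Z_1+Z_2)^2+h^4(U_0-U_2)^2}$. Consequently, $$\beta_{\mathsf{TSPD}}\le\frac{1}{\sqrt2}\left[\left(1+\frac{4}{3\alpha^2}\right)\left(1+\frac{4}{\alpha^2}\right)\right]^{1/4}.$$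
   Context: Traveling Salesman Problem with Drone (TSPD). Let $\|\cdot\|_T$ (truck metric) and $\|\cdot\|_D$ (drone metric) be norms on $\mathbb{R}^2$, and let $\mathcal X\subset\mathbb{R}^2$ be a finite set of customer points (nodes). In a solution each node is exactly one of: a truck node (visited only by the truck), a drone node (served only by the drone), or a combined node (visited by both vehicles; a synchronization point). A ring $r$ is given by two distinct combined nodes serving as start and end nodes, together with at most one drone node and any number (possibly zero) of truck nodes between them. In ring $r$ the truck follows a path $\mathcal T_r$ from the start node through all truck nodes of the ring (in some order) to the end node, and, if a drone node is present, the drone follows the path $\mathcal D_r$ from the start node to the drone node to the end node. With $t(\mathcal T_r)$ the sum of the $\|\cdot\|_T$-lengths of the edges of $\mathcal T_r$ and $d(\mathcal D_r)$ the sum of the $\|\cdot\|_D$-lengths of the edges of $\mathcal D_r$, the cost $c(r)$ of the ring is the minimum, over the choices of $\mathcal T_r,\mathcal D_r$, of $\max\{t(\mathcal T_r),d(\mathcal D_r)\}$ if the ring contains a drone node, and of $t(\mathcal T_r)$ otherwise. A feasible solution for $\mathcal X$ is a set $\mathcal R(\mathcal X)$ of rings that together cover all points of $\mathcal X$ and are concatenated through their combined nodes to form a single cyclic tour; each point of $\mathcal X$ is served exactly once: a combined node is shared by exactly two adjacent rings, and every other point belongs to exactly one ring. The optimal makespan is $\mathsf{TSPD}(\mathcal X)=\min_{\mathcal R(\mathcal X)}\sum_{r\in\mathcal R(\mathcal X)}c(r)$. Conventions: $\mathsf{TSPD}(\mathcal X)=0$ if $|\mathcal X|\le1$, and $\mathsf{TSPD}(\{x,y\})=2\|x-y\|_T$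 for $x\ne y$. Speed-scaled Euclidean model: $\|p\|_T=\|p\|_2$ and $\|p\|_D=\frac1\alpha\|p\|_2$, where $\alpha\ge1$. Asymptotic constant: for $X_1,X_2,\ldots$ i.i.d. uniform on $[0,1]^2$, $\beta_{\mathsf{TSPD}}$ is the constant such that $\mathsf{TSPD}(\{X_1,\ldots,X_n\})/\sqrt n\to\beta_{\mathsf{TSPD}}$ almost surely and in expectation as $n\to\infty$ (this limit is known to exist). *)

theory Defs
  imports "HOL-Probability.Probability"
begin

text \<open>Nodes are points of the plane.  The truck metric \<open>NT\<close> and the drone metric \<open>ND\<close> are
  passed as functions on difference vectors, and are meant to be norms.

  Rings are oriented from start to end node.  This does not affect their cost, and it keeps two
  rings apart that join the same two combined nodes (one in each direction), so that a solution
  can be a set of rings even when it has exactly two of them.  The order in which the truck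
  visits its nodes is not part of a ring; it is minimized over in \<open>ring_cost\<close>.\<close>

type_synonym point = "real ^ 2"

datatype tspd_ring = Ring
  (start_node: point) (truck_nodes: "point set") (drone_node: "point option") (end_node: point)

fun path_length :: "(point \<Rightarrow> real) \<Rightarrow> point list \<Rightarrow> real" where
  "path_length N (x # y # p) = N (y - x) + path_length N (y # p)"
| "path_length N _ = 0"

definition truck_paths :: "tspd_ring \<Rightarrow> point list set" where
  "truck_paths r =
     {start_node r # ts @ [end_node r] | ts. distinct ts \<and> set ts = truck_nodes r}"

definition ring_cost :: "(point \<Rightarrow> real) \<Rightarrow> (point \<Rightarrow> real) \<Rightarrow> tspd_ring \<Rightarrow> real" where
  "ring_cost NT ND r = (MIN p \<in> truck_paths r.
     case drone_node r of
       None \<Rightarrow> path_length NT p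
     | Some d \<Rightarrow> max (path_length NT p) (path_length ND [start_node r, d, end_node r]))"

definition interior_nodes :: "tspd_ring \<Rightarrow> point set" where
  "interior_nodes r = truck_nodes r \<union> set_option (drone_node r)"

definition valid_ring :: "tspd_ring \<Rightarrow> bool" where
  "valid_ring r \<longleftrightarrow> start_node r \<noteq> end_node r \<and> truck_nodes r \<inter> set_option (drone_node r) = {}"

text \<open>Every combined node is the start node of exactly one ring and the end node of exactly one
  other ring, and following the rings runs through all of them in a single cycle.\<close>

definition forms_cyclic_tour :: "tspd_ring set \<Rightarrow> bool" where
  "forms_cyclic_tour R \<longleftrightarrow> (\<exists>rs. rs \<noteq> [] \<and> set rs = R \<and> distinct (map start_node rs) \<and>
     (\<forall>i<length rs. end_node (rs ! i) = start_node (rs ! (Suc i mod length rs))))"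

definition feasible :: "point set \<Rightarrow> tspd_ring set \<Rightarrow> bool" where
  "feasible X R \<longleftrightarrow>
     (\<forall>r\<in>R. valid_ring r) \<and>
     forms_cyclic_tour R \<and>
     start_node ` R \<union> (\<Union>r\<in>R. interior_nodes r) = X \<and>
     start_node ` R \<inter> (\<Union>r\<in>R. interior_nodes r) = {} \<and>
     disjoint_family_on interior_nodes R"

definition TSPD :: "(point \<Rightarrow> real) \<Rightarrow> (point \<Rightarrow> real) \<Rightarrow> point set \<Rightarrow> real" where
  "TSPD NT ND X = (if card X \<le> 1 then 0
     else (MIN R \<in> {R. feasible X R}. \<Sum>r\<in>R. ring_cost NT ND r))"

definition euclidean_TSPD :: "real \<Rightarrow> point set \<Rightarrow> real" where
  "euclidean_TSPD \<alpha> = TSPD norm (\<lambda>p. norm p / \<alpha>)"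

text \<open>The minima above range over finite nonempty sets, and the convention for two nodes is a
  consequence of the general definition.\<close>

lemma finite_truck_paths:
  assumes "finite (truck_nodes r)"
  shows "finite (truck_paths r)"
proof -
  have "truck_paths r \<subseteq> (\<lambda>ts. start_node r # ts @ [end_node r]) `
      {ts. set ts \<subseteq> truck_nodes r \<and> distinct ts}"
    by (auto simp: truck_paths_def)
  then show ?thesis
    by (rule finite_subset) (intro finite_imageI finite_subset_distinct assms)
qed

lemma truck_paths_nonempty:
  assumes "finite (truck_nodes r)"
  shows "truck_paths r \<noteq> {}"
  using finite_distinct_list[OF assms] by (auto simp: truck_paths_def)

lemma feasible_end_node:
  assumes "feasible X R" "r \<in> R"
  shows "end_node r \<in> start_node ` R"
proof -
  obtain rs where rs: "set rs = R"
      "\<And>i. i < length rs \<Longrightarrow> end_node (rs ! i) = start_node (rs ! (Suc i mod length rs))"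
    using assms by (auto simp: feasible_def forms_cyclic_tour_def)
  obtain i where i: "i < length rs" "r = rs ! i"
    using assms(2) unfolding rs(1)[symmetric] by (auto simp: in_set_conv_nth)
  have "Suc i mod length rs < length rs"
    using i by (intro mod_less_divisor) auto
  then have "rs ! (Suc i mod length rs) \<in> R"
    using rs(1) nth_mem by blast
  then show ?thesis
    using rs(2)[OF i(1)] i(2) by auto
qed

lemma finite_feasible:
  assumes "finite X"
  shows "finite {R. feasible X R}"
proof -
  let ?A = "(\<lambda>(s, T, d, e). Ring s T d e) ` (X \<times> Pow X \<times> insert None (Some ` X) \<times> X)"
  have "R \<subseteq> ?A" if "feasible X R" for R
  proof
    fix r assume r: "r \<in> R"
    have "start_node r \<in> X" "truck_nodes r \<subseteq> X" "set_option (drone_node r) \<subseteq> X"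
      using that r by (auto simp: feasible_def interior_nodes_def)
    moreover have "end_node r \<in> X"
      using feasible_end_node[OF that r] that by (auto simp: feasible_def)
    ultimately show "r \<in> ?A"
      by (cases r; cases "drone_node r") (auto simp: image_iff)
  qed
  then have "{R. feasible X R} \<subseteq> Pow ?A"
    by blast
  moreover have "finite (Pow ?A)"
    using assms by auto
  ultimately show ?thesis
    by (rule finite_subset)
qed

lemma feasible_nonempty:
  assumes "finite X" "x \<in> X" "y \<in> X" "x \<noteq> y"
  shows "\<exists>R. feasible X R"
proof -
  let ?rs = "[Ring x (X - {x, y}) None y, Ring y {} None x]"
  have "feasible X (set ?rs)"
    unfolding feasible_def
  proof (intro conjI)
    show "forms_cyclic_tour (set ?rs)"
      unfolding forms_cyclic_tour_def
      by (rule exI[of _ ?rs]) (use assms in \<open>auto simp: less_Suc_eq\<close>)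
  qed (use assms in \<open>auto simp: valid_ring_def interior_nodes_def disjoint_family_on_def\<close>)
  then show ?thesis by blast
qed

lemma feasible_two_nodes:
  assumes "x \<noteq> y"
  shows "feasible {x, y} R \<longleftrightarrow> R = {Ring x {} None y, Ring y {} None x}" (is "_ \<longleftrightarrow> R = ?R")
proof
  assume f: "feasible {x, y} R"
  let ?S = "start_node ` R" and ?I = "\<Union>r\<in>R. interior_nodes r"
  have valid: "\<forall>r\<in>R. start_node r \<noteq> end_node r"
    and tour: "forms_cyclic_tour R" and cover: "?S \<union> ?I = {x, y}" and disj: "?S \<inter> ?I = {}"
    using f by (simp_all add: feasible_def valid_ring_def)
  have ends: "start_node r \<in> ?S" "end_node r \<in> ?S" "start_node r \<noteq> end_node r"
    if "r \<in> R" for r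
    using that valid feasible_end_node[OF f that] by simp_all
  have sub: "?S \<subseteq> {x, y}"
    using cover by blast
  have "R \<noteq> {}"
    using tour by (auto simp: forms_cyclic_tour_def)
  then obtain r0 where r0: "r0 \<in> R"
    by blast
  have "start_node r0 \<in> {x, y}" "end_node r0 \<in> {x, y}"
    using ends(1,2)[OF r0] sub by (meson subsetD)+
  then have "x \<in> ?S \<and> y \<in> ?S"
    using ends[OF r0] by auto
  then have S: "?S = {x, y}"
    using sub by blast
  have I: "?I = {}"
    using S cover disj by blast
  have mem: "r = Ring x {} None y \<or> r = Ring y {} None x" if "r \<in> R" for r
  proof -
    have "start_node r \<in> {x, y}" "end_node r \<in> {x, y}" "start_node r \<noteq> end_node r"
      using ends[OF that] S by simp_all
    moreover have "interior_nodes r = {}"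
      using I that by blast
    then have "truck_nodes r = {}" "drone_node r = None"
      by (simp_all add: interior_nodes_def)
    ultimately show ?thesis
      by (cases r) auto
  qed
  have "x \<in> ?S" "y \<in> ?S"
    using S by simp_all
  then obtain r s where rs: "r \<in> R" "start_node r = x" "s \<in> R" "start_node s = y"
    by blast
  have "r = Ring x {} None y"
    using mem[OF rs(1)] rs(2) assms by (metis tspd_ring.sel(1))
  moreover have "s = Ring y {} None x"
    using mem[OF rs(3)] rs(4) assms by (metis tspd_ring.sel(1))
  ultimately show "R = ?R"
    using mem rs(1,3) by blast
next
  assume R: "R = ?R"
  have "forms_cyclic_tour ?R"
    unfolding forms_cyclic_tour_def
    by (rule exI[of _ "[Ring x {} None y, Ring y {} None x]"])
      (use assms in \<open>auto simp: less_Suc_eq\<close>)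
  then show "feasible {x, y} R"
    unfolding R feasible_def using assms
    by (auto simp: valid_ring_def interior_nodes_def disjoint_family_on_def)
qed

lemma TSPD_two_nodes:
  assumes "x \<noteq> y" "NT (x - y) = NT (y - x)"
  shows "TSPD NT ND {x, y} = 2 * NT (x - y)"
proof -
  have "{R. feasible {x, y} R} = {{Ring x {} None y, Ring y {} None x}}"
    by (simp add: feasible_two_nodes[OF assms(1)])
  then show ?thesis
    using assms by (simp add: TSPD_def ring_cost_def truck_paths_def)
qed

end

(* Cut the unit square into K horizontal strips and run through them alternately to the right and
   to the left.  The passing time t of a point and its relative height u in its strip are independent
   and uniform on [0,1].  Visiting the points in the order of t, let every second point be a drone
   node; the tours with the odd and with the even points as drone nodes together use each triple of
   consecutive points once, so TSPD is at most half the sum of the ring costs of all consecutive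
   triples, up to O(1) for the border crossings and the closing edge.  Three given points are
   consecutive with gaps p, q in t with probability at most exp (-(n - 3) * (p + q)), because the
   other n - 3 points avoid the interval; summing over the at most n^3 ordered triples replaces the
   gaps by independent exponential variables, scaled by 1 / (n - 3).  With K about sqrt n / h this
   yields the bound of the theorem, with no need for Poissonization or order statistics.

   The closed form follows from max {a, b}^2 <= a^2 + b^2, (a + b)^2 <= 2 * (a^2 + b^2) and Jensen's
   inequality, with the optimal h^4 = A / B for a second moment A + B * h^4. *)

theory Submission
  imports Defs "HOL-Real_Asymp.Real_Asymp"
begin


subsection \<open>Tours with alternating drone nodes\<close>

text \<open>Splitting the vertical coordinate into strip index and relative height is what makes the
  pair (t, u) exactly uniform and independent, with no special case for edges that cross a border.
  Only the relative height enters the length under the root. The price is the growth of the index, 1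
  / K per strip; as indices never decrease along the order, these increments telescope, wherever the
  crossings fall. The parameter h stands for sqrt m / K with m = n - 3. A typical horizontal gap is
  K / m and the strip height is 1 / K, so their ratio is h^2; this is the origin of h^4 under the
  roots. The probability estimate is (1 - x)^m <= exp (- m * x), and it factors over the two gaps
  because x = p + q. Each gap then contributes a factor 1 / m and the rescaled length a factor K /
  m. So n^3 triples give n^3 * K / m^3, which is asymptotic to sqrt n / h: summing over all ordered
  triples loses nothing to first order. Since only upper bounds are wanted, nonnegative extended
  integrals suffice until the final moments, and the exact joint law of the gaps never
  appears.\<close>

fun ring_path :: "point \<Rightarrow> tspd_ring list \<Rightarrow> point \<Rightarrow> bool" where
  "ring_path a [] b \<longleftrightarrow> a = b"
| "ring_path a (r # rs) b \<longleftrightarrow> start_node r = a \<and> ring_path (end_node r) rs b"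

lemma ring_path_append:
  "ring_path a (rs @ ss) c \<longleftrightarrow> (\<exists>b. ring_path a rs b \<and> ring_path b ss c)"
  by (induction rs arbitrary: a) auto

lemma ring_path_nth:
  assumes "ring_path a rs b" "i < length rs"
  shows "end_node (rs ! i) = (if Suc i < length rs then start_node (rs ! Suc i) else b)"
  using assms
proof (induction rs arbitrary: a i)
  case (Cons r rs)
  show ?case
  proof (cases i)
    case 0
    then show ?thesis using Cons.prems by (cases rs) auto
  next
    case (Suc j)
    then show ?thesis using Cons by auto
  qed
qed simp

text \<open>The end node is left out because it is the start node of the next ring. Thus
  concatenation along a closed chain of rings lists every node once.\<close>

definition ring_nodes :: "tspd_ring \<Rightarrow> point list" where
  "ring_nodes r = start_node r # (case drone_node r of None \<Rightarrow> [] | Some d \<Rightarrow> [d])"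

text \<open>All disjointness conditions of feasibility reduce to distinctness of one concatenated
  list, and the cyclic condition to a chain that returns to its starting node.\<close>

lemma feasible_ring_path:
  assumes path: "ring_path a rs a" and "rs \<noteq> []"
    and truck: "\<And>r. r \<in> set rs \<Longrightarrow> truck_nodes r = {}"
    and ends: "\<And>r. r \<in> set rs \<Longrightarrow> start_node r \<noteq> end_node r"
    and dist: "distinct (concat (map ring_nodes rs))"
  shows "feasible (set (concat (map ring_nodes rs))) (set rs)" and "distinct rs"
proof -
  have nodes: "set (ring_nodes r) = insert (start_node r) (interior_nodes r)"
    "start_node r \<in> set (ring_nodes r)" "interior_nodes r = set_option (drone_node r)"
    if "r \<in> set rs" for r
    using truck[OF that] by (auto simp: ring_nodes_def interior_nodes_def split: option.splits)
  have starts: "distinct (map start_node rs)"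
    using dist by (induction rs) (auto simp: ring_nodes_def)
  then show "distinct rs"
    by (rule distinct_map[THEN iffD1, THEN conjunct1])
  have disj: "set (ring_nodes r) \<inter> set (ring_nodes s) = {}"
    if "r \<in> set rs" "s \<in> set rs" "r \<noteq> s" for r s
    using dist that by (induction rs) (auto simp: ring_nodes_def split: option.splits)
  have self: "start_node r \<notin> interior_nodes r" if "r \<in> set rs" for r
  proof -
    have "distinct (ring_nodes r)"
      using dist that by (simp add: distinct_concat_iff)
    then show ?thesis
      using nodes(3)[OF that] by (auto simp: ring_nodes_def split: option.splits)
  qed
  have "forms_cyclic_tour (set rs)"
    unfolding forms_cyclic_tour_def
  proof (intro exI[of _ rs] conjI allI impI)
    fix i assume i: "i < length rs"
    have "start_node (rs ! 0) = a"
      using path \<open>rs \<noteq> []\<close> by (cases rs) auto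
    then show "end_node (rs ! i) = start_node (rs ! (Suc i mod length rs))"
      using ring_path_nth[OF path i] i
      by (metis Suc_lessI mod_less mod_self)
  qed (use assms starts in auto)
  moreover have "start_node ` set rs \<union> (\<Union>r\<in>set rs. interior_nodes r)
      = set (concat (map ring_nodes rs))"
    using nodes(1) by auto
  moreover have "start_node ` set rs \<inter> (\<Union>r\<in>set rs. interior_nodes r) = {}"
  proof -
    have "start_node r \<notin> interior_nodes s" if "r \<in> set rs" "s \<in> set rs" for r s
      using disj[OF that] self nodes that by (cases "r = s") auto
    then show ?thesis by auto
  qed
  moreover have "disjoint_family_on interior_nodes (set rs)"
    unfolding disjoint_family_on_def using disj nodes(1) by blast
  moreover have "valid_ring r" if "r \<in> set rs" for r
    using truck ends that by (simp add: valid_ring_def)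
  ultimately show "feasible (set (concat (map ring_nodes rs))) (set rs)"
    by (simp add: feasible_def)
qed

lemma TSPD_le_ring_path:
  assumes "ring_path a rs a"
    and "\<And>r. r \<in> set rs \<Longrightarrow> truck_nodes r = {}"
    and "\<And>r. r \<in> set rs \<Longrightarrow> start_node r \<noteq> end_node r"
    and "concat (map ring_nodes rs) = ps" "distinct ps" "2 \<le> length ps"
  shows "TSPD NT ND (set ps) \<le> sum_list (map (ring_cost NT ND) rs)"
proof -
  have "rs \<noteq> []" using assms by auto
  with assms have f: "feasible (set ps) (set rs)" "distinct rs"
    using feasible_ring_path[of a rs] by auto
  have "card (set ps) \<ge> 2"
    using assms distinct_card by fastforce
  then have "TSPD NT ND (set ps) = (MIN R\<in>{R. feasible (set ps) R}. \<Sum>r\<in>R. ring_cost NT ND r)"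
    by (simp add: TSPD_def)
  also have "\<dots> \<le> (\<Sum>r\<in>set rs. ring_cost NT ND r)"
    using f finite_feasible[of "set ps"] by (intro Min_le) auto
  also have "\<dots> = sum_list (map (ring_cost NT ND) rs)"
    using f by (simp add: sum_list_distinct_conv_sum_set)
  finally show ?thesis .
qed

text \<open>Successive rings overlap in the combined node \<open>c\<close>. If the number of nodes
  is even, the last step is a truck edge without drone.\<close>

fun drone_rings :: "point list \<Rightarrow> tspd_ring list" where
  "drone_rings (a # b # c # ps) = Ring a {} (Some b) c # drone_rings (c # ps)"
| "drone_rings [a, b] = [Ring a {} None b]"
| "drone_rings _ = []"

lemma ring_path_drone_rings: "ps \<noteq> [] \<Longrightarrow> ring_path (hd ps) (drone_rings ps) (last ps)"
  by (induction ps rule: drone_rings.induct) auto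

text \<open>The last node is missing because it starts the ring that closes the tour, which is added
  separately.\<close>

lemma ring_nodes_drone_rings: "concat (map ring_nodes (drone_rings ps)) = butlast ps"
  by (induction ps rule: drone_rings.induct) (auto simp: ring_nodes_def)

lemma truck_nodes_drone_rings: "r \<in> set (drone_rings ps) \<Longrightarrow> truck_nodes r = {}"
  by (induction ps rule: drone_rings.induct) auto

lemma ends_drone_rings:
  "distinct ps \<Longrightarrow> r \<in> set (drone_rings ps) \<Longrightarrow> start_node r \<noteq> end_node r"
  by (induction ps rule: drone_rings.induct) auto

section \<open>Sums over consecutive triples of a list\<close>

fun triple_sum :: "('a \<Rightarrow> 'a \<Rightarrow> 'a \<Rightarrow> real) \<Rightarrow> 'a list \<Rightarrow> real" where
  "triple_sum g (a # b # c # xs) = g a b c + triple_sum g (b # c # xs)"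
| "triple_sum g _ = 0"

lemma triple_sum_map:
  "triple_sum g (map f xs) = triple_sum (\<lambda>a b c. g (f a) (f b) (f c)) xs"
  by (induction "\<lambda>a b c. g (f a) (f b) (f c)" xs rule: triple_sum.induct) auto

lemma triple_sum_add:
  "triple_sum (\<lambda>a b c. f a b c + g a b c) xs = triple_sum f xs + triple_sum g xs"
  by (induction f xs rule: triple_sum.induct) auto

lemma triple_sum_mono:
  assumes "sorted_wrt P xs" "\<And>a b c. \<lbrakk>a \<in> set xs; b \<in> set xs; c \<in> set xs; P a b; P a c; P b c\<rbrakk> \<Longrightarrow> f a b c \<le> g a b c"
  shows "triple_sum f xs \<le> triple_sum g xs"
  using assms by (induction f xs rule: triple_sum.induct) (auto intro!: add_mono)

text \<open>The sum collapses to the last two values of \<open>\<kappa>\<close> minus the first two.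
  Applied to the strip indices divided by K, it bounds the total cost of the border
  crossings.\<close>

lemma triple_sum_telescope:
  assumes "\<And>x. x \<in> set xs \<Longrightarrow> 0 \<le> \<kappa> x \<and> \<kappa> x \<le> B" "0 \<le> B"
  shows "triple_sum (\<lambda>a b c. \<kappa> c - \<kappa> a) xs \<le> 2 * B"
proof -
  have "triple_sum (\<lambda>a b c. \<kappa> c - \<kappa> a) (a # b # xs) \<le> 2 * B - \<kappa> a - \<kappa> b"
    if "\<And>x. x \<in> set (a # b # xs) \<Longrightarrow> \<kappa> x \<le> B" for a b xs
    using that
  proof (induction xs arbitrary: a b)
    case Nil
    show ?case using Nil[of a] Nil[of b] by simp
  next
    case (Cons c xs)
    have "triple_sum (\<lambda>a b c. \<kappa> c - \<kappa> a) (b # c # xs) \<le> 2 * B - \<kappa> b - \<kappa> c"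
      using Cons.prems by (intro Cons.IH) auto
    then show ?case by simp
  qed
  note two = this
  show ?thesis
  proof (cases xs)
    case (Cons a ys)
    show ?thesis
    proof (cases ys)
      case (Cons b zs)
      have "triple_sum (\<lambda>a b c. \<kappa> c - \<kappa> a) xs \<le> 2 * B - \<kappa> a - \<kappa> b" "0 \<le> \<kappa> a" "0 \<le> \<kappa> b"
        using two[of a b zs] assms(1) by (auto simp: \<open>xs = a # ys\<close> Cons)
      then show ?thesis by linarith
    qed (use \<open>0 \<le> B\<close> \<open>xs = a # ys\<close> in simp)
  qed (use \<open>0 \<le> B\<close> in simp)
qed

lemma triple_sum_conv_nth:
  "triple_sum g xs = (\<Sum>m<length xs - 2. g (xs ! m) (xs ! Suc m) (xs ! Suc (Suc m)))"
  by (induction g xs rule: triple_sum.induct) (auto simp: sum.lessThan_Suc_shift simp del: sum.lessThan_Suc)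

definition drone_triple_cost :: "(point \<Rightarrow> real) \<Rightarrow> (point \<Rightarrow> real) \<Rightarrow> point \<Rightarrow> point \<Rightarrow> point \<Rightarrow> real" where
  "drone_triple_cost NT ND a b c = max (NT (c - a)) (ND (b - a) + ND (c - b))"

lemma ring_cost_no_truck_nodes:
  "ring_cost NT ND (Ring a {} None b) = NT (b - a)"
  "ring_cost NT ND (Ring a {} (Some d) b) = drone_triple_cost NT ND a d b"
  by (simp_all add: ring_cost_def truck_paths_def drone_triple_cost_def)

text \<open>The tours with the drone at the odd and at the even positions of a list of nodes together
  use every consecutive triple once, so the shorter one costs at most half the triple sum.\<close>

lemma cost_drone_rings:
  assumes "\<And>p q. p \<in> set (a # ps) \<Longrightarrow> q \<in> set (a # ps) \<Longrightarrow> NT (q - p) \<le> D" "0 \<le> D"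
  shows "sum_list (map (ring_cost NT ND) (drone_rings (a # ps)))
       + sum_list (map (ring_cost NT ND) (drone_rings ps))
     \<le> triple_sum (drone_triple_cost NT ND) (a # ps) + D"
  using assms(1)
proof (induction ps arbitrary: a)
  case (Cons b ps)
  show ?case
  proof (cases ps)
    \<comment> \<open>Of the two ring lists exactly one ends in a leftover pair of nodes;
      \<open>D\<close> pays for this truck edge.\<close>
    case Nil
    then show ?thesis using Cons.prems[of a b] by (simp add: ring_cost_no_truck_nodes)
  next
    case (Cons c q)
    have "sum_list (map (ring_cost NT ND) (drone_rings (b # ps)))
       + sum_list (map (ring_cost NT ND) (drone_rings ps))
     \<le> triple_sum (drone_triple_cost NT ND) (b # ps) + D"
      using Cons.prems by (intro Cons.IH) auto
    then show ?thesis by (simp add: Cons ring_cost_no_truck_nodes)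
  qed
qed (use assms in simp)

text \<open>Twice the optimum is at most the cost of both tours together. Beyond the triple sum
  these use four edges of length at most \<open>D\<close>: the leftover truck edge, the closing edge
  of each tour, and the opening edge of the shifted tour.\<close>

lemma TSPD_le_triple_sum:
  assumes "distinct ps" "2 \<le> length ps"
    and D: "\<And>p q. p \<in> set ps \<Longrightarrow> q \<in> set ps \<Longrightarrow> NT (q - p) \<le> D" "0 \<le> D"
  shows "TSPD NT ND (set ps) \<le> triple_sum (drone_triple_cost NT ND) ps / 2 + 2 * D"
proof -
  obtain a b qs where ps: "ps = a # b # qs"
    using assms(2) by (metis One_nat_def Suc_1 Suc_le_length_iff)
  define close where "close = Ring (last ps) {} None a"
  let ?cost = "\<lambda>rs. sum_list (map (ring_cost NT ND) rs)"
  have ne: "ps \<noteq> []" by (simp add: ps)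
  have last: "last ps \<noteq> a" "last ps \<in> set ps" "a \<in> set ps" "b \<in> set ps" "a \<noteq> b"
    using assms(1) by (auto simp: ps)
  have "TSPD NT ND (set ps) \<le> ?cost (drone_rings ps @ [close])"
  proof (rule TSPD_le_ring_path[where a = a])
    show "ring_path a (drone_rings ps @ [close]) a"
      using ring_path_drone_rings[OF ne] by (auto simp: ring_path_append close_def ps)
    show "concat (map ring_nodes (drone_rings ps @ [close])) = ps"
      using append_butlast_last_id[OF ne]
      by (simp add: ring_nodes_drone_rings) (simp add: ring_nodes_def close_def)
  qed (use assms last truck_nodes_drone_rings ends_drone_rings in \<open>auto simp: close_def\<close>)
  \<comment> \<open>An opening truck edge from \<open>a\<close> to \<open>b\<close> moves the drone
    nodes to the positions of the other parity.\<close>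
  moreover have "TSPD NT ND (set ps) \<le> ?cost (Ring a {} None b # drone_rings (tl ps) @ [close])"
  proof (rule TSPD_le_ring_path[where a = a])
    show "ring_path a (Ring a {} None b # drone_rings (tl ps) @ [close]) a"
      using ring_path_drone_rings[of "tl ps"] by (auto simp: ring_path_append close_def ps)
    have "butlast (tl ps) @ [last ps] = tl ps"
      by (simp add: ps)
    then show "concat (map ring_nodes (Ring a {} None b # drone_rings (tl ps) @ [close])) = ps"
      by (simp add: ring_nodes_drone_rings) (simp add: ring_nodes_def close_def ps)
  next
    fix r assume "r \<in> set (Ring a {} None b # drone_rings (tl ps) @ [close])"
    then show "truck_nodes r = {}" "start_node r \<noteq> end_node r"
      using assms last truck_nodes_drone_rings[of r "tl ps"] ends_drone_rings[of "tl ps" r]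
      by (auto simp: close_def distinct_tl)
  qed (use assms in auto)
  moreover have "?cost (drone_rings ps) + ?cost (drone_rings (tl ps))
      \<le> triple_sum (drone_triple_cost NT ND) ps + D"
    using cost_drone_rings[of a "b # qs" NT D ND] D by (simp add: ps)
  moreover have "ring_cost NT ND close \<le> D" "NT (b - a) \<le> D"
    using D last by (auto simp: close_def ring_cost_no_truck_nodes)
  ultimately show ?thesis
    by (simp add: ring_cost_no_truck_nodes)
qed

subsection \<open>The strip order\<close>

text \<open>The boustrophedon order: the unit square is cut into \<open>K\<close> horizontal strips, traversed
  alternately to the right and to the left.  The time at which a point is passed is scaled to
  \<open>[0, 1]\<close>.\<close>

definition strip :: "nat \<Rightarrow> point \<Rightarrow> int" where
  "strip K p = \<lfloor>real K * p $ 2\<rfloor>"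

definition strip_time :: "nat \<Rightarrow> point \<Rightarrow> real" where
  "strip_time K p = (strip K p + (if even (strip K p) then p $ 1 else 1 - p $ 1)) / K"

definition strip_height :: "nat \<Rightarrow> point \<Rightarrow> real" where
  "strip_height K p = frac (real K * p $ 2)"

text \<open>The whole route has horizontal length K, so a time gap \<open>s\<close> is a horizontal
  way of length K * s; heights are measured in units of the strip height 1 / K.\<close>

definition strip_dist :: "real \<Rightarrow> real \<Rightarrow> real \<Rightarrow> real" where
  "strip_dist K s v = sqrt (K\<^sup>2 * s\<^sup>2 + v\<^sup>2 / K\<^sup>2)"

lemma unit_square_iff: "p \<in> cbox 0 (1 :: point) \<longleftrightarrow> 0 \<le> p $ 1 \<and> p $ 1 \<le> 1 \<and> 0 \<le> p $ 2 \<and> p $ 2 \<le> 1"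
  by (auto simp: mem_box_cart forall_2)

text \<open>For positive \<open>K\<close> the index \<open>K\<close> itself occurs only on the upper
  edge \<open>p $ 2 = 1\<close>. Admitting it keeps the pathwise estimates valid on the closed
  square.\<close>

lemma strip_bounds:
  assumes "p \<in> cbox 0 1"
  shows "0 \<le> strip K p" "strip K p \<le> K"
proof -
  have "real K * p $ 2 \<le> real K * 1"
    using assms by (intro mult_left_mono) (auto simp: unit_square_iff)
  then show "strip K p \<le> K"
    by (simp add: strip_def floor_le_iff)
qed (use assms in \<open>simp add: unit_square_iff strip_def\<close>)

lemma strip_real_bounds:
  assumes "p \<in> cbox 0 1"
  shows "0 \<le> real_of_int (strip K p)" "real_of_int (strip K p) \<le> real K"
  using strip_bounds[OF assms, of K] by linarith+

lemma strip_time_bounds: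
  assumes "p \<in> cbox 0 1" "0 < K"
  shows "strip K p \<le> K * strip_time K p" "K * strip_time K p \<le> strip K p + 1"
  using assms by (auto simp: unit_square_iff strip_time_def)

lemma strip_mono:
  assumes "p \<in> cbox 0 1" "q \<in> cbox 0 1" "0 < K" "strip_time K p < strip_time K q"
  shows "strip K p \<le> strip K q"
proof (rule ccontr)
  assume "\<not> ?thesis"
  then have "real_of_int (strip K q) + 1 \<le> strip K p"
    by linarith
  then have "K * strip_time K q \<le> K * strip_time K p"
    using strip_time_bounds[of p K] strip_time_bounds[of q K] assms by linarith
  then show False
    using assms by simp
qed

text \<open>The right-hand side is the horizontal way along the route. In one strip it equals the
  difference; across one border it is the detour by the turning side, at 1 or at 0 according to
  parity; with a full strip in between it is at least the width of the square.\<close>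

lemma strip_horizontal_dist:
  assumes "p \<in> cbox 0 1" "q \<in> cbox 0 1" "0 < K" "strip_time K p < strip_time K q"
  shows "\<bar>q $ 1 - p $ 1\<bar> \<le> K * (strip_time K q - strip_time K p)"
proof -
  have le: "strip K p \<le> strip K q"
    using strip_mono assms by blast
  consider "strip K q = strip K p" | "strip K q = strip K p + 1" | "strip K q \<ge> strip K p + 2"
    using le by linarith
  then show ?thesis
  proof cases
    case 1
    then show ?thesis using assms by (auto simp: strip_time_def field_simps)
  next
    case 2
    then have "K * (strip_time K q - strip_time K p) = (if even (strip K p) then 2 - q $ 1 - p $ 1 else q $ 1 + p $ 1)"
      using assms(3) by (simp add: strip_time_def right_diff_distrib)
    then show ?thesis using assms by (auto simp: unit_square_iff)
  next
    case 3
    then have "real_of_int (strip K p) + 2 \<le> strip K q"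
      by linarith
    then have "1 \<le> K * (strip_time K q - strip_time K p)"
      using strip_time_bounds[of p K] strip_time_bounds[of q K] assms
      by (simp add: right_diff_distrib)
    then show ?thesis using assms by (auto simp: unit_square_iff)
  qed
qed

text \<open>Triangle inequality for the vectors (x, u) and (0, k): the difference of relative
  heights stays under the root, while the index increase \<open>k\<close> is paid outside it and can
  telescope.\<close>

lemma norm_le_strip_dist:
  assumes "p \<in> cbox 0 1" "q \<in> cbox 0 1" "0 < K" "strip_time K p < strip_time K q"
  shows "norm (q - p) \<le> strip_dist K (strip_time K q - strip_time K p) (strip_height K q - strip_height K p)
       + (strip K q - strip K p) / K"
proof -
  define x where "x = K * (strip_time K q - strip_time K p)"
  define u where "u = (strip_height K q - strip_height K p) / K"
  define k where "k = (strip K q - strip K p) / K"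
  have y: "q $ 2 - p $ 2 = u + k"
    using assms(3) by (simp add: u_def k_def strip_height_def strip_def frac_def field_simps)
  have k: "0 \<le> k"
    using strip_mono[OF assms] by (simp add: k_def)
  have "norm (q - p) = sqrt ((q $ 1 - p $ 1)\<^sup>2 + (u + k)\<^sup>2)"
    by (simp add: norm_vec_def L2_set_def sum_2 y)
  also have "\<dots> \<le> sqrt (x\<^sup>2 + (u + k)\<^sup>2)"
  proof -
    have "\<bar>q $ 1 - p $ 1\<bar> \<le> \<bar>x\<bar>"
      using strip_horizontal_dist[OF assms] by (simp add: x_def)
    then show ?thesis
      by (simp add: abs_le_square_iff)
  qed
  also have "\<dots> \<le> sqrt (x\<^sup>2 + u\<^sup>2) + sqrt (0\<^sup>2 + k\<^sup>2)"
    using real_sqrt_sum_squares_triangle_ineq[of x 0 u k] by simp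
  also have "\<dots> = sqrt (x\<^sup>2 + u\<^sup>2) + k"
    using k by simp
  also have "sqrt (x\<^sup>2 + u\<^sup>2) = strip_dist K (strip_time K q - strip_time K p) (strip_height K q - strip_height K p)"
    by (simp add: strip_dist_def x_def u_def power_mult_distrib power_divide)
  finally show ?thesis by (simp add: k_def)
qed

text \<open>Here \<open>l\<close> gives the length of an edge from its gap in the strip order and the
  difference of the relative heights of its end points.\<close>

definition gap_cost :: "real \<Rightarrow> (real \<Rightarrow> real \<Rightarrow> real) \<Rightarrow> real \<Rightarrow> real \<Rightarrow> real \<Rightarrow> real \<Rightarrow> real \<Rightarrow> real" where
  "gap_cost \<alpha> l z1 z2 u0 u1 u2 =
     max (l (z1 + z2) (u0 - u2)) (1 / \<alpha> * (l z1 (u0 - u1) + l z2 (u1 - u2)))"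

definition strip_cost :: "real \<Rightarrow> nat \<Rightarrow> real \<times> real \<Rightarrow> real \<times> real \<Rightarrow> real \<times> real \<Rightarrow> real" where
  "strip_cost \<alpha> K a b c =
     gap_cost \<alpha> (strip_dist K) (fst b - fst a) (fst c - fst b) (snd a) (snd b) (snd c)"

definition strip_coords :: "nat \<Rightarrow> point \<Rightarrow> real \<times> real" where
  "strip_coords K p = (strip_time K p, strip_height K p)"

text \<open>The index increase from \<open>p\<close> to \<open>r\<close> occurs in the truck length
  and, divided by \<open>\<alpha>\<close>, in the drone length. Since
  \<open>1 \<le> \<alpha>\<close>, one undivided copy can be taken out of the maximum.\<close>

lemma drone_triple_cost_le_strip_cost:
  assumes "p \<in> cbox 0 1" "q \<in> cbox 0 1" "r \<in> cbox 0 1" "0 < K" "1 \<le> \<alpha>"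
    and "strip_time K p < strip_time K q" "strip_time K q < strip_time K r"
  shows "drone_triple_cost norm (\<lambda>p. norm p / \<alpha>) p q r
     \<le> strip_cost \<alpha> K (strip_coords K p) (strip_coords K q) (strip_coords K r)
       + (strip K r / K - strip K p / K)"
proof -
  let ?t = "strip_time K" and ?u = "strip_height K" and ?k = "\<lambda>p. strip K p / K"
  define l where "l p q = strip_dist K (?t q - ?t p) (?u q - ?u p)" for p q
  have sym: "strip_dist K s (v - w) = strip_dist K s (w - v)" for s v w
    by (simp add: strip_dist_def power2_commute)
  have pq: "norm (q - p) \<le> l p q + (?k q - ?k p)" and qr: "norm (r - q) \<le> l q r + (?k r - ?k q)"
    and pr: "norm (r - p) \<le> l p r + (?k r - ?k p)"
    using norm_le_strip_dist[of p q K] norm_le_strip_dist[of q r K] norm_le_strip_dist[of p r K] assms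
    by (auto simp: l_def diff_divide_distrib)
  have k: "0 \<le> ?k r - ?k p"
    using strip_mono[of p r K] assms by (simp add: divide_right_mono)
  have "norm (q - p) / \<alpha> + norm (r - q) / \<alpha> \<le> (l p q + l q r + (?k r - ?k p)) / \<alpha>"
    using pq qr assms(5) by (simp add: add_divide_distrib[symmetric] divide_right_mono)
  also have "\<dots> \<le> (l p q + l q r) / \<alpha> + (?k r - ?k p)"
    using divide_left_mono[OF assms(5) k] assms(5) by (simp add: add_divide_distrib)
  finally show ?thesis
    using pr unfolding drone_triple_cost_def strip_cost_def gap_cost_def strip_coords_def l_def
    by (simp add: sym add.commute max_def)
qed

section \<open>Sorted orders and consecutive triples of indices\<close>

lemma exists_sorted_enumeration:
  fixes t :: "'i \<Rightarrow> real"
  assumes "finite I" "inj_on t I"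
  obtains xs where "set xs = I" "distinct xs" "sorted_wrt (\<lambda>i j. t i < t j) xs"
proof -
  define xs where "xs = map (the_inv_into I t) (sorted_list_of_set (t ` I))"
  have t: "map t xs = sorted_list_of_set (t ` I)"
    unfolding xs_def map_map
    by (rule map_idI) (use assms in \<open>auto simp: f_the_inv_into_f\<close>)
  have "sorted_wrt (<) (map t xs)"
    unfolding t by simp
  then have 1: "sorted_wrt (\<lambda>i j. t i < t j) xs"
    by (simp add: sorted_wrt_map)
  have 2: "distinct xs"
    using t by (metis distinct_map distinct_sorted_list_of_set)
  have "set xs = I"
    using assms by (auto simp: xs_def the_inv_into_f_f image_iff)
  with 1 2 show ?thesis using that by blast
qed

text \<open>Phrased through the values of \<open>t\<close> alone, without any sorted list, so that
  for random points it is an event determined by their coordinates.\<close>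

definition consecutive :: "'i set \<Rightarrow> ('i \<Rightarrow> real) \<Rightarrow> 'i \<Rightarrow> 'i \<Rightarrow> 'i \<Rightarrow> bool" where
  "consecutive I t i j k \<longleftrightarrow> t i < t j \<and> t j < t k \<and> (\<forall>l\<in>I - {i, j, k}. t l \<notin> {t i..t k})"

text \<open>This removes the random order from the sum: the index set becomes fixed, and
  expectations can be taken term by term. Distinct positions give distinct triples because
  \<open>t\<close> is strictly increasing along the list.\<close>

lemma triple_sum_le_consecutive:
  assumes xs: "set xs = I" "sorted_wrt (\<lambda>i j. t i < t j) xs"
    and g: "\<And>i j k. 0 \<le> g i j k"
  shows "triple_sum g xs \<le> (\<Sum>(i, j, k)\<in>I \<times> I \<times> I. if consecutive I t i j k then g i j k else 0)"
proof -
  let ?f = "\<lambda>m. (xs ! m, xs ! Suc m, xs ! Suc (Suc m))"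
  let ?A = "{..<length xs - 2}"
  have lt: "t (xs ! a) < t (xs ! b)" if "a < b" "b < length xs" for a b
    using xs(2) that by (auto simp: sorted_wrt_iff_nth_less)
  have inj: "inj_on ?f ?A"
  proof (rule inj_onI)
    fix a b assume ab: "a \<in> ?A" "b \<in> ?A" "?f a = ?f b"
    then have "a < length xs" "b < length xs"
      by auto
    then show "a = b"
      using lt[of a b] lt[of b a] ab(3) by (cases a b rule: linorder_cases) auto
  qed
  have cons: "consecutive I t (xs ! m) (xs ! Suc m) (xs ! Suc (Suc m))" if "m \<in> ?A" for m
    unfolding consecutive_def
  proof (intro conjI ballI)
    fix l assume l: "l \<in> I - {xs ! m, xs ! Suc m, xs ! Suc (Suc m)}"
    then obtain a where a: "l = xs ! a" "a < length xs"
      using xs(1) by (auto simp: in_set_conv_nth)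
    then have "a < m \<or> Suc (Suc m) < a"
      using l by (cases "a = m"; cases "a = Suc m"; cases "a = Suc (Suc m)") auto
    moreover have "m < length xs"
      using that by auto
    ultimately show "t l \<notin> {t (xs ! m)..t (xs ! Suc (Suc m))}"
      using lt[of a m] lt[of "Suc (Suc m)" a] a by auto
  qed (use that lt in auto)
  have "triple_sum g xs = (\<Sum>m\<in>?A. (\<lambda>(i, j, k). if consecutive I t i j k then g i j k else 0) (?f m))"
    using cons by (simp add: triple_sum_conv_nth)
  also have "\<dots> = (\<Sum>(i, j, k)\<in>?f ` ?A. if consecutive I t i j k then g i j k else 0)"
    using inj by (simp only: sum.reindex o_def)
  also have "\<dots> \<le> (\<Sum>(i, j, k)\<in>I \<times> I \<times> I. if consecutive I t i j k then g i j k else 0)"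
    using g xs(1) by (intro sum_mono2) auto
  finally show ?thesis .
qed

lemma strip_cost_nonneg: "1 \<le> \<alpha> \<Longrightarrow> 0 \<le> strip_cost \<alpha> K a b c"
  by (simp add: strip_cost_def gap_cost_def strip_dist_def le_max_iff_disj)

text \<open>In the additive constant, 1 is half of the telescoped strip indices, which are at most 1
  after division by \<open>K\<close>, and 2 * sqrt 2 is twice the diameter of the unit square.
  Injectivity of the passing times also makes the points distinct.\<close>

lemma euclidean_TSPD_le_consecutive:
  assumes I: "finite I" "2 \<le> card I" and P: "\<And>i. i \<in> I \<Longrightarrow> P i \<in> cbox 0 1"
    and inj: "inj_on (\<lambda>i. strip_time K (P i)) I" and K: "0 < K" and \<alpha>: "1 \<le> \<alpha>"
  shows "euclidean_TSPD \<alpha> (P ` I) \<le>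
    (\<Sum>(i, j, k)\<in>I \<times> I \<times> I. if consecutive I (\<lambda>i. fst (strip_coords K (P i))) i j k
       then strip_cost \<alpha> K (strip_coords K (P i)) (strip_coords K (P j)) (strip_coords K (P k)) else 0) / 2
    + (1 + 2 * sqrt 2)"
proof -
  let ?t = "\<lambda>i. strip_time K (P i)"
  let ?g = "\<lambda>i j k. strip_cost \<alpha> K (strip_coords K (P i)) (strip_coords K (P j)) (strip_coords K (P k))"
  obtain xs where xs: "set xs = I" "distinct xs" "sorted_wrt (\<lambda>i j. ?t i < ?t j) xs"
    using exists_sorted_enumeration[OF I(1) inj] by blast
  have "inj_on P I"
    using inj by (auto simp: inj_on_def)
  then have dist: "distinct (map P xs)"
    using xs by (simp add: distinct_map)
  have len: "2 \<le> length (map P xs)"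
    using xs I(2) distinct_card[of xs] by simp
  have diam: "norm (q - p) \<le> sqrt 2" if "p \<in> set (map P xs)" "q \<in> set (map P xs)" for p q
  proof -
    have pq: "p \<in> cbox 0 1" "q \<in> cbox 0 1"
      using that xs(1) P by auto
    then have "(q $ 1 - p $ 1)\<^sup>2 \<le> 1" "(q $ 2 - p $ 2)\<^sup>2 \<le> 1"
      by (auto simp: abs_square_le_1 unit_square_iff)
    then show ?thesis
      by (simp add: norm_vec_def L2_set_def sum_2)
  qed
  have "triple_sum (drone_triple_cost norm (\<lambda>p. norm p / \<alpha>)) (map P xs)
      = triple_sum (\<lambda>i j k. drone_triple_cost norm (\<lambda>p. norm p / \<alpha>) (P i) (P j) (P k)) xs"
    by (rule triple_sum_map)
  also have "\<dots> \<le> triple_sum (\<lambda>i j k. ?g i j k + (strip K (P k) / K - strip K (P i) / K)) xs"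
    using xs(1) P K \<alpha>
    by (intro triple_sum_mono[OF xs(3)] drone_triple_cost_le_strip_cost) auto
  also have "\<dots> \<le> triple_sum ?g xs + 2 * 1"
    unfolding triple_sum_add
    using xs(1) P K strip_real_bounds
    by (intro add_left_mono triple_sum_telescope[where \<kappa> = "\<lambda>i. strip K (P i) / K"])
       (auto simp: divide_le_eq_1)
  also have "triple_sum ?g xs \<le> (\<Sum>(i, j, k)\<in>I \<times> I \<times> I. if consecutive I ?t i j k then ?g i j k else 0)"
    by (intro triple_sum_le_consecutive xs strip_cost_nonneg \<alpha>)
  finally have "triple_sum (drone_triple_cost norm (\<lambda>p. norm p / \<alpha>)) (map P xs) / 2
      \<le> (\<Sum>(i, j, k)\<in>I \<times> I \<times> I. if consecutive I ?t i j k then ?g i j k else 0) / 2 + 1"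
    by simp
  moreover have "euclidean_TSPD \<alpha> (P ` I)
      \<le> triple_sum (drone_triple_cost norm (\<lambda>p. norm p / \<alpha>)) (map P xs) / 2 + 2 * sqrt 2"
    using TSPD_le_triple_sum[OF dist len, of norm "sqrt 2"] diam xs(1) by (simp add: euclidean_TSPD_def)
  ultimately show ?thesis
    by (simp add: strip_coords_def)
qed


subsection \<open>The law of the strip coordinates\<close>

abbreviation unit_uniform :: "real measure" where
  "unit_uniform \<equiv> uniform_measure lborel {0..1}"

lemma prob_space_unit_uniform: "prob_space unit_uniform"
  by (rule prob_space_uniform_measure) auto

lemma nn_integral_unit_uniform:
  assumes [measurable]: "f \<in> borel_measurable borel"
  shows "(\<integral>\<^sup>+x. f x \<partial>unit_uniform) = (\<integral>\<^sup>+x. f x * indicator {0..1} x \<partial>lborel)"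
  by (subst nn_integral_uniform_measure) (auto simp: divide_ennreal_def)

section \<open>Lebesgue measure of the plane in coordinates\<close>

lemma vector_2_eq: "(vector [x, y] :: point) = (\<chi> i. if i = 1 then x else y)"
  by (simp add: vec_eq_iff forall_2)

lemma continuous_on_vector_2:
  assumes "continuous_on S f" "continuous_on S g"
  shows "continuous_on S (\<lambda>z. vector [f z, g z] :: point)"
proof -
  have "continuous_on S (\<lambda>z. if i = (1::2) then f z else g z)" for i
    using assms by (cases "i = 1") auto
  then show ?thesis
    unfolding vector_2_eq by (intro continuous_on_vec_lambda)
qed

lemma prod_Basis_plane:
  fixes f :: "point \<Rightarrow> 'b::comm_monoid_mult"
  shows  "(\<Prod>b\<in>Basis. f b) = f (axis 1 1) * f (axis 2 1)"
proof -
  have 1: "(Basis :: point set) = {axis 1 1, axis 2 1}"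
    by (auto simp: Basis_vec_def UNIV_2)
  have 2: "axis 1 1 \<noteq> (axis 2 1 :: point)"
    by (simp add: axis_eq_axis)
  show ?thesis
    unfolding 1 using 2 by (subst prod.insert) auto
qed

text \<open>Both measures give a box the product of its side lengths, which determines Lebesgue
  measure. It makes Fubini available for the two components of \<open>real ^ 2\<close>.\<close>

lemma lborel_plane: "(lborel :: point measure) = distr (lborel \<Otimes>\<^sub>M lborel) borel (\<lambda>(x, y). vector [x, y])"
proof (rule lborel_eqI)
  have "continuous_on UNIV (\<lambda>(x, y). vector [x, y] :: point)"
    unfolding case_prod_beta by (intro continuous_on_vector_2 continuous_intros)
  then have [measurable]: "(\<lambda>(x, y). vector [x, y] :: point) \<in> borel_measurable (lborel \<Otimes>\<^sub>M lborel)"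
    by (simp add: borel_measurable_continuous_onI borel_prod lborel_prod)
  fix l u :: point
  assume le: "\<And>b. b \<in> Basis \<Longrightarrow> l \<bullet> b \<le> u \<bullet> b"
  have le': "l $ i \<le> u $ i" for i
    using le[of "axis i 1"] by (simp add: inner_axis)
  have "(\<lambda>(x, y). vector [x, y] :: point) -` box l u \<inter> space (lborel \<Otimes>\<^sub>M lborel)
      = {l $ 1<..<u $ 1} \<times> {l $ 2<..<u $ 2}"
    by (auto simp: space_pair_measure mem_box_cart forall_2)
  then have "emeasure (distr (lborel \<Otimes>\<^sub>M lborel) borel (\<lambda>(x, y). vector [x, y])) (box l u)
      = emeasure (lborel \<Otimes>\<^sub>M lborel) ({l $ 1<..<u $ 1} \<times> {l $ 2<..<u $ 2})"
    by (simp add: emeasure_distr)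
  also have "\<dots> = ennreal (u $ 1 - l $ 1) * ennreal (u $ 2 - l $ 2)"
    using le' by (simp add: lborel.emeasure_pair_measure_Times)
  also have "\<dots> = (\<Prod>b\<in>Basis. (u - l) \<bullet> b)"
    using le' by (simp add: prod_Basis_plane inner_axis ennreal_mult)
  finally show "emeasure (distr (lborel \<Otimes>\<^sub>M lborel) borel (\<lambda>(x, y). vector [x, y])) (box l u)
      = (\<Prod>b\<in>Basis. (u - l) \<bullet> b)" .
qed simp

lemma measurable_strip_coords [measurable]: "strip_coords K \<in> borel_measurable borel"
proof -
  have [measurable]: "(\<lambda>p::point. p $ i) \<in> borel_measurable borel" for i
    by (intro borel_measurable_continuous_onI continuous_intros)
  have [measurable]: "strip K \<in> measurable borel (count_space UNIV)"
    unfolding strip_def by measurable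
  show ?thesis
    unfolding strip_coords_def strip_time_def strip_height_def frac_def strip_def[symmetric]
    by measurable
qed

text \<open>Substitution x = (k + s) / K on each of the K cells. It is used in both directions: to
  cut the vertical axis into strips, and to glue the strips together into the time axis.\<close>

lemma nn_integral_unit_interval_split:
  fixes f :: "real \<Rightarrow> ennreal" and K :: nat
  assumes [measurable]: "f \<in> borel_measurable borel" and "0 < K"
  shows "(\<integral>\<^sup>+x. f x * indicator {0..1} x \<partial>lborel)
    = (\<Sum>k<K. ennreal (1 / K) * (\<integral>\<^sup>+s. f ((k + s) / K) * indicator {0..<1} s \<partial>lborel))"
proof -
  have ind: "(\<Sum>k<K. indicator {k / K..<(k + 1) / K} x) = (indicator {0..<1} x :: ennreal)" for x :: real
  proof (cases "x \<in> {0..<1}")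
    case True
    define k where "k = nat \<lfloor>K * x\<rfloor>"
    have "K * x < K" "0 \<le> K * x"
      using True \<open>0 < K\<close> by auto
    then have k: "k < K" "k \<le> K * x" "K * x < k + 1"
      unfolding k_def by linarith+
    have iff: "x \<in> {j / K..<(j + 1) / K} \<longleftrightarrow> j = k" for j :: nat
    proof
      assume "x \<in> {j / K..<(j + 1) / K}"
      then have "j \<le> K * x" "K * x < j + 1"
        using \<open>0 < K\<close> by (auto simp: field_simps)
      then show "j = k" using k by linarith
    qed (use k \<open>0 < K\<close> in \<open>auto simp: field_simps\<close>)
    have "(\<Sum>j<K. indicator {j / K..<(j + 1) / K} x) = (\<Sum>j<K. if j = k then 1 else 0 :: ennreal)"
      using iff by (intro sum.cong) (auto simp: indicator_def)
    then show ?thesis using k True by simp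
  next
    case False
    have "x \<notin> {j / K..<(j + 1) / K}" if "j < K" for j :: nat
    proof
      assume x: "x \<in> {j / K..<(j + 1) / K}"
      then have "j \<le> K * x" "K * x < j + 1"
        using \<open>0 < K\<close> by (auto simp: field_simps)
      moreover have "real (j + 1) \<le> K" using that by linarith
      ultimately have "0 \<le> K * x" "K * x < K * 1" by linarith+
      then show False
        using False \<open>0 < K\<close> by (auto simp: zero_le_mult_iff)
    qed
    then show ?thesis using False by (auto simp: indicator_def intro!: sum.neutral)
  qed
  have cell: "(\<integral>\<^sup>+x. f x * indicator {k / K..<(k + 1) / K} x \<partial>lborel)
      = ennreal (1 / K) * (\<integral>\<^sup>+s. f ((k + s) / K) * indicator {0..<1} s \<partial>lborel)" for k :: nat
  proof -
    have "(k / K + 1 / K * s) = (k + s) / K" for s :: real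
      by (simp add: add_divide_distrib)
    moreover have "indicator {k / K..<(k + 1) / K} ((k + s) / K) = (indicator {0..<1} s :: ennreal)" for s :: real
      using \<open>0 < K\<close> by (auto simp: indicator_def field_simps)
    ultimately show ?thesis
      using \<open>0 < K\<close> by (subst nn_integral_real_affine[where t = "k / K" and c = "1 / K"]) simp_all
  qed
  have "AE x in lborel. f x * indicator {0..1} x = f x * indicator {0..<1::real} x"
    using AE_lborel_singleton[of 1] by eventually_elim (auto simp: indicator_def)
  then have "(\<integral>\<^sup>+x. f x * indicator {0..1} x \<partial>lborel) = (\<integral>\<^sup>+x. f x * indicator {0..<1} x \<partial>lborel)"
    by (rule nn_integral_cong_AE)
  also have "\<dots> = (\<integral>\<^sup>+x. (\<Sum>k<K. f x * indicator {k / K..<(k + 1) / K} x) \<partial>lborel)"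
    by (simp add: ind[symmetric] sum_distrib_left)
  also have "\<dots> = (\<Sum>k<K. \<integral>\<^sup>+x. f x * indicator {k / K..<(k + 1) / K} x \<partial>lborel)"
    by (rule nn_integral_sum) measurable
  finally show ?thesis by (simp only: cell)
qed

lemma nn_integral_unit_interval_reflect:
  fixes f :: "real \<Rightarrow> ennreal"
  assumes [measurable]: "f \<in> borel_measurable borel"
  shows "(\<integral>\<^sup>+x. f (1 - x) * indicator {0..1} x \<partial>lborel) = (\<integral>\<^sup>+x. f x * indicator {0..1} x \<partial>lborel)"
proof -
  have "indicator {0..1} (1 - x) = (indicator {0..1} x :: ennreal)" for x :: real
    by (auto simp: indicator_def)
  then show ?thesis
    by (subst (2) nn_integral_real_affine[where t = 1 and c = "-1"]) simp_all
qed

lemma nn_integral_half_open: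
  fixes f :: "real \<Rightarrow> ennreal"
  shows "(\<integral>\<^sup>+x. f x * indicator {0..<1} x \<partial>lborel) = (\<integral>\<^sup>+x. f x * indicator {0..1} x \<partial>lborel)"
proof (rule nn_integral_cong_AE)
  show "AE x in lborel. f x * indicator {0..<1} x = f x * indicator {0..1::real} x"
    using AE_lborel_singleton[of 1] by eventually_elim (auto simp: indicator_def)
qed

lemma nn_integral_unit_square:
  fixes f :: "point \<Rightarrow> ennreal"
  assumes [measurable]: "f \<in> borel_measurable borel"
  shows "(\<integral>\<^sup>+p. f p \<partial>uniform_measure lborel (cbox 0 1))
    = (\<integral>\<^sup>+x. (\<integral>\<^sup>+y. f (vector [x, y]) * indicator {0..1} y \<partial>lborel) * indicator {0..1} x \<partial>lborel)"
proof -
  have "continuous_on UNIV (\<lambda>(x, y). vector [x, y] :: point)"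
    unfolding case_prod_beta by (intro continuous_on_vector_2 continuous_intros)
  then have v [measurable]: "(\<lambda>(x, y). vector [x, y] :: point) \<in> borel_measurable (lborel \<Otimes>\<^sub>M lborel)"
    by (simp add: borel_measurable_continuous_onI borel_prod lborel_prod)
  have [measurable]: "(\<lambda>y. vector [x, y] :: point) \<in> borel_measurable borel" for x
    using measurable_compose_Pair1[OF _ v, of x] by simp
  have one: "emeasure lborel (cbox 0 (1::point)) = 1"
  proof -
    have "0 \<le> (1 :: point) \<bullet> b" if "b \<in> Basis" for b
      using that by (auto simp: Basis_vec_def inner_axis)
    then show ?thesis
      by (simp add: emeasure_lborel_cbox_eq prod_Basis_plane inner_axis)
  qed
  have "(\<integral>\<^sup>+p. f p \<partial>uniform_measure lborel (cbox 0 1)) = (\<integral>\<^sup>+p. f p * indicator (cbox 0 1) p \<partial>lborel)"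
    by (subst nn_integral_uniform_measure) (auto simp: one divide_ennreal_def)
  also have "\<dots> = (\<integral>\<^sup>+x. \<integral>\<^sup>+y. f (vector [x, y]) * indicator (cbox 0 1) (vector [x, y] :: point) \<partial>lborel \<partial>lborel)"
  proof -
    let ?f = "\<lambda>p. f p * indicator (cbox 0 1) p"
    have "(\<integral>\<^sup>+p. ?f p \<partial>lborel) = (\<integral>\<^sup>+z. ?f (case z of (x, y) \<Rightarrow> vector [x, y]) \<partial>(lborel \<Otimes>\<^sub>M lborel))"
      by (subst lborel_plane, rule nn_integral_distr) (use v in measurable)
    also have "\<dots> = (\<integral>\<^sup>+x. \<integral>\<^sup>+y. ?f (case (x, y) of (x, y) \<Rightarrow> vector [x, y]) \<partial>lborel \<partial>lborel)"
      by (rule lborel.nn_integral_fst[symmetric]) (use v in measurable)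
    finally show ?thesis by simp
  qed
  also have "\<dots> = (\<integral>\<^sup>+x. \<integral>\<^sup>+y. (f (vector [x, y]) * indicator {0..1} y) * indicator {0..1} x \<partial>lborel \<partial>lborel)"
    by (intro nn_integral_cong) (auto simp: indicator_def unit_square_iff)
  also have "\<dots> = (\<integral>\<^sup>+x. (\<integral>\<^sup>+y. f (vector [x, y]) * indicator {0..1} y \<partial>lborel) * indicator {0..1} x \<partial>lborel)"
    by (intro nn_integral_cong nn_integral_multc) measurable
  finally show ?thesis .
qed

text \<open>Given strip k, the relative height is uniform, and the horizontal position, reflected in
  odd strips, is uniform as well. Averaging (k + x) / K over the strips fills the time interval
  uniformly, independently of the height.\<close>

lemma nn_integral_strip_coords:
  assumes [measurable]: "g \<in> borel_measurable borel" and K: "0 < K"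
  shows "(\<integral>\<^sup>+p. g (strip_coords K p) \<partial>uniform_measure lborel (cbox 0 1))
    = (\<integral>\<^sup>+t. \<integral>\<^sup>+u. g (t, u) \<partial>unit_uniform \<partial>unit_uniform)"
proof -
  define \<xi> :: "nat \<Rightarrow> real \<Rightarrow> real" where "\<xi> k x = (if even k then x else 1 - x)" for k x
  have [measurable]: "\<xi> k \<in> borel_measurable borel" for k
    by (cases "even k") (simp_all add: \<xi>_def[abs_def])
  have [measurable]: "(\<lambda>y. vector [x, y] :: point) \<in> borel_measurable borel" for x
    by (intro borel_measurable_continuous_onI continuous_on_vector_2 continuous_intros)
  have coords: "strip_coords K (vector [x, (k + u) / K]) = ((k + \<xi> k x) / K, u)"
    if "u \<in> {0..<1}" for x u :: real and k :: nat
  proof -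
    have "real K * ((k + u) / K) = k + u"
      using K by simp
    moreover have "\<lfloor>k + u\<rfloor> = int k" "frac (k + u) = u"
      using that by (auto simp: floor_eq_iff frac_def)
    ultimately show ?thesis
      by (simp add: strip_coords_def strip_time_def strip_height_def strip_def \<xi>_def)
  qed
  have "(\<integral>\<^sup>+p. g (strip_coords K p) \<partial>uniform_measure lborel (cbox 0 1))
    = (\<integral>\<^sup>+x. (\<integral>\<^sup>+y. g (strip_coords K (vector [x, y])) * indicator {0..1} y \<partial>lborel) * indicator {0..1} x \<partial>lborel)"
    by (rule nn_integral_unit_square) measurable
  also have "\<dots> = (\<integral>\<^sup>+x. (\<Sum>k<K. ennreal (1 / K) * (\<integral>\<^sup>+u. g (strip_coords K (vector [x, (k + u) / K])) * indicator {0..<1} u \<partial>lborel)) * indicator {0..1} x \<partial>lborel)"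
    using K by (subst nn_integral_unit_interval_split) auto
  also have "\<dots> = (\<integral>\<^sup>+x. (\<Sum>k<K. ennreal (1 / K) * (\<integral>\<^sup>+u. g ((k + \<xi> k x) / K, u) * indicator {0..<1} u \<partial>lborel)) * indicator {0..1} x \<partial>lborel)"
  proof -
    have "(\<integral>\<^sup>+u. g (strip_coords K (vector [x, (k + u) / K])) * indicator {0..<1} u \<partial>lborel)
        = (\<integral>\<^sup>+u. g ((k + \<xi> k x) / K, u) * indicator {0..<1} u \<partial>lborel)" for x :: real and k :: nat
      by (intro nn_integral_cong) (auto simp: indicator_def coords)
    then show ?thesis by simp
  qed
  also have "\<dots> = (\<integral>\<^sup>+x. (\<Sum>k<K. ennreal (1 / K) * (\<integral>\<^sup>+u. g ((k + \<xi> k x) / K, u) \<partial>unit_uniform)) * indicator {0..1} x \<partial>lborel)"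
    by (simp add: nn_integral_half_open nn_integral_unit_uniform)
  also have "\<dots> = (\<Sum>k<K. ennreal (1 / K) * (\<integral>\<^sup>+x. (\<integral>\<^sup>+u. g ((k + \<xi> k x) / K, u) \<partial>unit_uniform) * indicator {0..1} x \<partial>lborel))"
  proof -
    interpret prob_space unit_uniform by (rule prob_space_unit_uniform)
    show ?thesis
      unfolding sum_distrib_right mult.assoc
      by (subst nn_integral_sum, measurable) (intro sum.cong nn_integral_cmult refl, measurable)
  qed
  also have "\<dots> = (\<Sum>k<K. ennreal (1 / K) * (\<integral>\<^sup>+x. (\<integral>\<^sup>+u. g ((k + x) / K, u) \<partial>unit_uniform) * indicator {0..1} x \<partial>lborel))"
  proof -
    interpret prob_space unit_uniform by (rule prob_space_unit_uniform)
    show ?thesis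
    proof (intro sum.cong refl arg_cong2[where f = "(*)"])
      fix k
      have "(\<lambda>x. \<integral>\<^sup>+u. g ((real k + x) / real K, u) \<partial>unit_uniform) \<in> borel_measurable borel"
        by measurable
      then show "(\<integral>\<^sup>+x. (\<integral>\<^sup>+u. g ((k + \<xi> k x) / K, u) \<partial>unit_uniform) * indicator {0..1} x \<partial>lborel)
        = (\<integral>\<^sup>+x. (\<integral>\<^sup>+u. g ((k + x) / K, u) \<partial>unit_uniform) * indicator {0..1} x \<partial>lborel)"
        using nn_integral_unit_interval_reflect[of "\<lambda>x. \<integral>\<^sup>+u. g ((real k + x) / real K, u) \<partial>unit_uniform"]
        by (cases "even k") (simp_all add: \<xi>_def)
    qed
  qed
  \<comment> \<open>The average over k and x is the cell decomposition of an integral over the time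
    t, read backwards.\<close>
  also have "\<dots> = (\<integral>\<^sup>+t. \<integral>\<^sup>+u. g (t, u) \<partial>unit_uniform \<partial>unit_uniform)"
  proof -
    interpret prob_space unit_uniform by (rule prob_space_unit_uniform)
    have [measurable]: "(\<lambda>t. \<integral>\<^sup>+u. g (t, u) \<partial>unit_uniform) \<in> borel_measurable borel"
      by measurable
    show ?thesis
      by (subst nn_integral_unit_uniform, measurable)
         (subst nn_integral_unit_interval_split[OF _ K], auto simp: nn_integral_half_open)
  qed
  finally show ?thesis .
qed


section \<open>The joint law of passing time and relative height\<close>

definition strip_law :: "(real \<times> real) measure" where
  "strip_law = unit_uniform \<Otimes>\<^sub>M unit_uniform"

lemma sets_strip_law [simp, measurable_cong]: "sets strip_law = sets borel"
  unfolding strip_law_def borel_prod[symmetric] by (intro sets_pair_measure_cong) auto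

lemma space_strip_law [simp]: "space strip_law = UNIV"
  using sets_eq_imp_space_eq[OF sets_strip_law] by simp

lemma prob_space_strip_law: "prob_space strip_law"
proof -
  interpret pair_prob_space unit_uniform unit_uniform
    by (simp add: pair_prob_space_def pair_sigma_finite_def prob_space_unit_uniform
      prob_space_imp_sigma_finite)
  show ?thesis unfolding strip_law_def by (rule prob_space_axioms)
qed

lemma nn_integral_strip_law:
  assumes "f \<in> borel_measurable borel"
  shows "(\<integral>\<^sup>+x. f x \<partial>strip_law) = (\<integral>\<^sup>+t. \<integral>\<^sup>+u. f (t, u) \<partial>unit_uniform \<partial>unit_uniform)"
proof -
  interpret prob_space unit_uniform by (rule prob_space_unit_uniform)
  have "f \<in> borel_measurable strip_law"
    using assms measurable_cong_sets[OF sets_strip_law refl] by blast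
  then show ?thesis
    unfolding strip_law_def by (rule nn_integral_fst[symmetric])
qed

lemma distr_strip_coords:
  assumes "0 < K"
  shows "distr (uniform_measure lborel (cbox 0 1)) borel (strip_coords K) = strip_law"
proof (rule measure_eqI)
  fix A assume "A \<in> sets (distr (uniform_measure lborel (cbox 0 1)) borel (strip_coords K))"
  then have [measurable]: "A \<in> sets borel" by simp
  have "emeasure (distr (uniform_measure lborel (cbox 0 1)) borel (strip_coords K)) A
    = (\<integral>\<^sup>+p. indicator A (strip_coords K p) \<partial>uniform_measure lborel (cbox 0 1))"
    by (subst nn_integral_indicator[symmetric], simp, subst nn_integral_distr) simp_all
  also have "\<dots> = (\<integral>\<^sup>+t. \<integral>\<^sup>+u. indicator A (t, u) \<partial>unit_uniform \<partial>unit_uniform)"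
    using assms by (intro nn_integral_strip_coords) simp_all
  also have "\<dots> = (\<integral>\<^sup>+x. indicator A x \<partial>strip_law)"
    by (rule nn_integral_strip_law[symmetric]) simp
  also have "\<dots> = emeasure strip_law A"
    by simp
  finally show "emeasure (distr (uniform_measure lborel (cbox 0 1)) borel (strip_coords K)) A = emeasure strip_law A" .
qed simp

lemma measurable_fst_plane [measurable]: "fst \<in> borel_measurable (borel :: (real \<times> real) measure)"
  by (intro borel_measurable_continuous_onI continuous_intros)

lemma measurable_snd_plane [measurable]: "snd \<in> borel_measurable (borel :: (real \<times> real) measure)"
  by (intro borel_measurable_continuous_onI continuous_intros)

subsection \<open>Consecutive triples of independent points\<close>

lemma measurable_not_in_atLeastAtMost:
  fixes f g h :: "'a \<Rightarrow> real"
  assumes [measurable]: "f \<in> borel_measurable M" "g \<in> borel_measurable M" "h \<in> borel_measurable M"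
  shows "Measurable.pred M (\<lambda>x. f x \<notin> {g x..h x})"
  unfolding atLeastAtMost_iff by measurable

lemma measurable_consecutive:
  assumes [measurable]: "t \<in> borel_measurable Q" "g \<in> borel_measurable (Q \<Otimes>\<^sub>M Q \<Otimes>\<^sub>M Q)"
    and I: "finite I" "i \<in> I" "j \<in> I" "k \<in> I"
  shows "(\<lambda>y. if consecutive I (\<lambda>l. t (y l)) i j k then g (y i, y j, y k) else (0 :: ennreal))
    \<in> borel_measurable (PiM I (\<lambda>_. Q))"
proof -
  have comp [measurable]: "(\<lambda>y. y l) \<in> measurable (PiM I (\<lambda>_. Q)) Q" if "l \<in> I" for l
    using that by (rule measurable_component_singleton)
  note [measurable] = comp[OF I(2)] comp[OF I(3)] comp[OF I(4)]
  have "Measurable.pred (PiM I (\<lambda>_. Q)) (\<lambda>y. \<forall>l\<in>I - {i, j, k}. t (y l) \<notin> {t (y i)..t (y k)})"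
  proof (rule pred_intros_finite(3))
    fix l assume "l \<in> I - {i, j, k}"
    then have "(\<lambda>y. t (y l)) \<in> borel_measurable (PiM I (\<lambda>_. Q))"
      by (intro measurable_compose[OF _ assms(1)] comp) auto
    moreover have "(\<lambda>y. t (y i)) \<in> borel_measurable (PiM I (\<lambda>_. Q))"
      "(\<lambda>y. t (y k)) \<in> borel_measurable (PiM I (\<lambda>_. Q))"
      by measurable
    ultimately show "Measurable.pred (PiM I (\<lambda>_. Q)) (\<lambda>y. t (y l) \<notin> {t (y i)..t (y k)})"
      by (rule measurable_not_in_atLeastAtMost)
  qed (use I in simp)
  then show ?thesis
    unfolding consecutive_def by measurable
qed

text \<open>Fubini: once the values at \<open>i\<close>, \<open>j\<close>, \<open>k\<close> are
  fixed, the remaining \<open>card I - 3\<close> coordinates are independent and each has to avoid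
  the same interval, so the indicator of the event integrates to a power.\<close>

lemma nn_integral_consecutive_triple:
  assumes Q: "prob_space Q" and [measurable]: "t \<in> borel_measurable Q" "g \<in> borel_measurable (Q \<Otimes>\<^sub>M Q \<Otimes>\<^sub>M Q)"
    and I: "finite I" "i \<in> I" "j \<in> I" "k \<in> I" "i \<noteq> j" "i \<noteq> k" "j \<noteq> k"
  shows "(\<integral>\<^sup>+y. (if consecutive I (\<lambda>l. t (y l)) i j k then g (y i, y j, y k) else 0) \<partial>PiM I (\<lambda>_. Q))
    = (\<integral>\<^sup>+a. \<integral>\<^sup>+b. \<integral>\<^sup>+c. (if t a < t b \<and> t b < t c
        then g (a, b, c) * emeasure Q {x \<in> space Q. t x \<notin> {t a..t c}} ^ (card I - 3) else 0) \<partial>Q \<partial>Q \<partial>Q)"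
proof -
  interpret prob_space Q by (rule Q)
  interpret product_sigma_finite "\<lambda>_. Q" by (simp add: product_sigma_finite_def sigma_finite_measure_axioms)
  define R where "R = I - {i, j, k}"
  have R: "finite R" "k \<notin> R" "j \<notin> insert k R" "i \<notin> insert j (insert k R)"
    and Ieq: "I = insert i (insert j (insert k R))"
    using I by (auto simp: R_def)
  have cardR: "card R = card I - 3"
    using R by (simp add: Ieq)
  let ?h = "\<lambda>y. if t (y i) < t (y j) \<and> t (y j) < t (y k) \<and> (\<forall>l\<in>R. t (y l) \<notin> {t (y i)..t (y k)})
      then g (y i, y j, y k) else 0"
  have m [measurable]: "?h \<in> borel_measurable (PiM (insert i (insert j (insert k R))) (\<lambda>_. Q))"
    using measurable_consecutive[OF assms(2,3) I(1-4)]
    unfolding consecutive_def R_def[symmetric] Ieq[symmetric] by (simp add: conj_assoc)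
  have m1: "(\<lambda>y. ?h (y(i := a))) \<in> borel_measurable (PiM (insert j (insert k R)) (\<lambda>_. Q))" if "a \<in> space Q" for a
    using that by measurable
  have m2: "(\<lambda>y. ?h (y(j := b, i := a))) \<in> borel_measurable (PiM (insert k R) (\<lambda>_. Q))" if "a \<in> space Q" "b \<in> space Q" for a b
    using that by measurable
  have "(\<integral>\<^sup>+y. (if consecutive I (\<lambda>l. t (y l)) i j k then g (y i, y j, y k) else 0) \<partial>PiM I (\<lambda>_. Q))
    = integral\<^sup>N (PiM (insert i (insert j (insert k R))) (\<lambda>_. Q)) ?h"
    unfolding consecutive_def R_def[symmetric] Ieq[symmetric] by (simp add: conj_assoc)
  also have "\<dots> = (\<integral>\<^sup>+a. (\<integral>\<^sup>+y. ?h (y(i := a)) \<partial>PiM (insert j (insert k R)) (\<lambda>_. Q)) \<partial>Q)"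
    using R m by (intro product_nn_integral_insert_rev) auto
  also have "\<dots> = (\<integral>\<^sup>+a. \<integral>\<^sup>+b. (\<integral>\<^sup>+y. ?h (y(j := b, i := a)) \<partial>PiM (insert k R) (\<lambda>_. Q)) \<partial>Q \<partial>Q)"
    using R by (intro nn_integral_cong product_nn_integral_insert_rev m1) auto
  also have "\<dots> = (\<integral>\<^sup>+a. \<integral>\<^sup>+b. \<integral>\<^sup>+c. (\<integral>\<^sup>+y. ?h (y(k := c, j := b, i := a)) \<partial>PiM R (\<lambda>_. Q)) \<partial>Q \<partial>Q \<partial>Q)"
    using R by (intro nn_integral_cong product_nn_integral_insert_rev m2) auto
  also have "\<dots> = (\<integral>\<^sup>+a. \<integral>\<^sup>+b. \<integral>\<^sup>+c. (if t a < t b \<and> t b < t c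
        then g (a, b, c) * emeasure Q {x \<in> space Q. t x \<notin> {t a..t c}} ^ (card I - 3) else 0) \<partial>Q \<partial>Q \<partial>Q)"
  proof (intro nn_integral_cong)
    fix a b c
    let ?A = "{x \<in> space Q. t x \<notin> {t a..t c}}"
    have [measurable]: "?A \<in> sets Q"
      unfolding atLeastAtMost_iff by measurable
    have "?h (y(k := c, j := b, i := a)) = (if t a < t b \<and> t b < t c then g (a, b, c) else 0)
        * (\<Prod>l\<in>R. indicator ?A (y l))" if "y \<in> space (PiM R (\<lambda>_. Q))" for y
    proof -
      have "y l \<in> space Q" if "l \<in> R" for l
        using that \<open>y \<in> space (PiM R (\<lambda>_. Q))\<close> by (auto simp: space_PiM)
      then have "(\<forall>l\<in>R. t ((y(k := c, j := b, i := a)) l) \<notin> {t a..t c}) \<longleftrightarrow> (\<forall>l\<in>R. y l \<in> ?A)"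
        by (auto simp: R_def)
      moreover have "(\<Prod>l\<in>R. indicator ?A (y l)) = (if \<forall>l\<in>R. y l \<in> ?A then 1 else 0 :: ennreal)"
      proof (cases "\<forall>l\<in>R. y l \<in> ?A")
        case False
        then show ?thesis using R(1) by (subst if_not_P) (auto simp: indicator_def intro!: prod_zero)
      qed (simp add: indicator_def)
      ultimately show ?thesis
        using I(5-7) by auto
    qed
    then have "(\<integral>\<^sup>+y. ?h (y(k := c, j := b, i := a)) \<partial>PiM R (\<lambda>_. Q))
      = (\<integral>\<^sup>+y. (if t a < t b \<and> t b < t c then g (a, b, c) else 0) * (\<Prod>l\<in>R. indicator ?A (y l)) \<partial>PiM R (\<lambda>_. Q))"
      by (rule nn_integral_cong)
    also have "\<dots> = (if t a < t b \<and> t b < t c then g (a, b, c) else 0) * (\<integral>\<^sup>+y. (\<Prod>l\<in>R. indicator ?A (y l)) \<partial>PiM R (\<lambda>_. Q))"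
      using R(1) by (intro nn_integral_cmult) measurable
    also have "(\<integral>\<^sup>+y. (\<Prod>l\<in>R. indicator ?A (y l)) \<partial>PiM R (\<lambda>_. Q)) = emeasure Q ?A ^ (card I - 3)"
      using R(1) by (subst product_nn_integral_prod) (auto simp: cardR)
    also have "(if t a < t b \<and> t b < t c then g (a, b, c) else 0) * emeasure Q ?A ^ (card I - 3)
      = (if t a < t b \<and> t b < t c then g (a, b, c) * emeasure Q ?A ^ (card I - 3) else 0)"
      by simp
    finally show "(\<integral>\<^sup>+y. ?h (y(k := c, j := b, i := a)) \<partial>PiM R (\<lambda>_. Q)) = (if t a < t b \<and> t b < t c
        then g (a, b, c) * emeasure Q ?A ^ (card I - 3) else 0)" .
  qed
  finally show ?thesis .
qed

section \<open>Rescaling gaps to exponential variables\<close>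

definition edge_length :: "real \<Rightarrow> real \<Rightarrow> real \<Rightarrow> real" where
  "edge_length h z v = sqrt (z\<^sup>2 + h ^ 4 * v\<^sup>2)"

abbreviation exp_law :: "real measure" where
  "exp_law \<equiv> density lborel (exponential_density 1)"

text \<open>Factoring (K / m)^2 out of the root leaves m^2 / K^4 in front of the squared height
  difference, which is the fourth power of sqrt m / K.\<close>

lemma strip_dist_rescale:
  assumes "0 < K" "0 < m"
  shows "strip_dist K (z / m) v = K / m * edge_length (sqrt m / K) z v"
proof -
  have "sqrt m ^ 4 = m\<^sup>2"
    using assms by (simp add: power4_eq_xxxx power2_eq_square)
  then have "K\<^sup>2 * (z / m)\<^sup>2 + v\<^sup>2 / K\<^sup>2 = (K / m)\<^sup>2 * (z\<^sup>2 + (sqrt m / K) ^ 4 * v\<^sup>2)"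
    using assms by (simp add: power_divide field_simps eval_nat_numeral)
  then show ?thesis
    using assms by (simp add: strip_dist_def edge_length_def real_sqrt_mult)
qed

lemma edge_length_mono: "0 \<le> h \<Longrightarrow> h \<le> h' \<Longrightarrow> edge_length h z v \<le> edge_length h' z v"
  by (auto simp: edge_length_def intro!: mult_right_mono power_mono)

text \<open>The cost is monotone and positively homogeneous in the edge lengths, so a bound for
  single edges carries over to a ring.\<close>

lemma gap_cost_le:
  assumes "0 \<le> c" "1 \<le> \<alpha>" "\<And>z v. l (z / m) v \<le> c * l' z v"
  shows "gap_cost \<alpha> l (z1 / m) (z2 / m) u0 u1 u2 \<le> c * gap_cost \<alpha> l' z1 z2 u0 u1 u2"
proof -
  have "(l (z1 / m) (u0 - u1) + l (z2 / m) (u1 - u2)) / \<alpha> \<le> (c * l' z1 (u0 - u1) + c * l' z2 (u1 - u2)) / \<alpha>"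
    using assms by (intro divide_right_mono add_mono) auto
  also have "\<dots> = c * (1 / \<alpha> * (l' z1 (u0 - u1) + l' z2 (u1 - u2)))"
    by (simp add: algebra_simps add_divide_distrib)
  also have "\<dots> \<le> c * gap_cost \<alpha> l' z1 z2 u0 u1 u2"
    unfolding gap_cost_def using assms(1) by (intro mult_left_mono) auto
  finally have "(l (z1 / m) (u0 - u1) + l (z2 / m) (u1 - u2)) / \<alpha> \<le> c * gap_cost \<alpha> l' z1 z2 u0 u1 u2" .
  moreover have "l ((z1 + z2) / m) (u0 - u2) \<le> c * gap_cost \<alpha> l' z1 z2 u0 u1 u2"
  proof -
    have "c * l' (z1 + z2) (u0 - u2) \<le> c * gap_cost \<alpha> l' z1 z2 u0 u1 u2"
      unfolding gap_cost_def using assms(1) by (intro mult_left_mono) auto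
    then show ?thesis
      using assms(3)[of "z1 + z2" "u0 - u2"] by linarith
  qed
  ultimately show ?thesis
    by (subst gap_cost_def) (simp add: add_divide_distrib)
qed

lemma measurable_gap_cost_strip_dist [measurable (raw)]:
  assumes [measurable]: "z1 \<in> borel_measurable M" "z2 \<in> borel_measurable M" "u0 \<in> borel_measurable M"
    "u1 \<in> borel_measurable M" "u2 \<in> borel_measurable M"
  shows "(\<lambda>x. gap_cost \<alpha> (strip_dist K) (z1 x) (z2 x) (u0 x) (u1 x) (u2 x)) \<in> borel_measurable M"
  unfolding gap_cost_def strip_dist_def by measurable

lemma measurable_gap_cost_edge_length [measurable (raw)]:
  assumes [measurable]: "z1 \<in> borel_measurable M" "z2 \<in> borel_measurable M" "u0 \<in> borel_measurable M"
    "u1 \<in> borel_measurable M" "u2 \<in> borel_measurable M"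
  shows "(\<lambda>x. gap_cost \<alpha> (edge_length h) (z1 x) (z2 x) (u0 x) (u1 x) (u2 x)) \<in> borel_measurable M"
  unfolding gap_cost_def edge_length_def by measurable

lemma measurable_strip_cost [measurable (raw)]:
  assumes [measurable]: "a \<in> borel_measurable M" "b \<in> borel_measurable M" "c \<in> borel_measurable M"
  shows "(\<lambda>x. strip_cost \<alpha> K (a x) (b x) (c x)) \<in> borel_measurable M"
proof -
  note fst = measurable_compose[OF _ measurable_fst_plane] and snd = measurable_compose[OF _ measurable_snd_plane]
  have [measurable]: "(\<lambda>x. fst (a x)) \<in> borel_measurable M" "(\<lambda>x. fst (b x)) \<in> borel_measurable M"
    "(\<lambda>x. fst (c x)) \<in> borel_measurable M" "(\<lambda>x. snd (a x)) \<in> borel_measurable M"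
    "(\<lambda>x. snd (b x)) \<in> borel_measurable M" "(\<lambda>x. snd (c x)) \<in> borel_measurable M"
    by (rule fst snd, rule assms)+
  show ?thesis
    unfolding strip_cost_def
    by (intro measurable_gap_cost_strip_dist borel_measurable_diff) fact+
qed

text \<open>Dropping the upper end of the unit interval and rescaling by \<open>m\<close> turns a gap density
  \<open>exp (- m * p)\<close> into an exponential gap.\<close>

lemma nn_integral_gap_le:
  fixes H :: "real \<Rightarrow> ennreal"
  assumes [measurable]: "H \<in> borel_measurable borel" and m: "0 < m"
  shows "(\<integral>\<^sup>+t. (if s < t then H (t - s) * ennreal (exp (- m * (t - s))) else 0) \<partial>unit_uniform)
    \<le> ennreal (1 / m) * (\<integral>\<^sup>+z. H (z / m) \<partial>exp_law)"
proof -
  let ?w = "\<lambda>p. if 0 < p then H p * ennreal (exp (- m * p)) else 0"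
  have "(\<integral>\<^sup>+t. (if s < t then H (t - s) * ennreal (exp (- m * (t - s))) else 0) \<partial>unit_uniform)
      = (\<integral>\<^sup>+t. ?w (t - s) \<partial>unit_uniform)"
    by simp
  also have "\<dots> = (\<integral>\<^sup>+t. ?w (t - s) * indicator {0..1} t \<partial>lborel)"
    by (rule nn_integral_unit_uniform) measurable
  also have "\<dots> \<le> (\<integral>\<^sup>+t. ?w (t - s) \<partial>lborel)"
    by (intro nn_integral_mono) (auto simp: indicator_def)
  also have "\<dots> = (\<integral>\<^sup>+p. ?w p \<partial>lborel)"
    using nn_integral_real_affine[of "\<lambda>t. ?w (t - s)" 1 s] by (simp cong: if_cong)
  also have "\<dots> = ennreal (1 / m) * (\<integral>\<^sup>+z. ?w (z / m) \<partial>lborel)"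
    using m by (subst nn_integral_real_affine[where c = "1 / m" and t = 0]) (simp_all cong: if_cong)
  also have "(\<integral>\<^sup>+z. ?w (z / m) \<partial>lborel) \<le> (\<integral>\<^sup>+z. exponential_density 1 z * H (z / m) \<partial>lborel)"
    using m by (intro nn_integral_mono) (auto simp: exponential_density_def mult.commute zero_less_divide_iff)
  also have "\<dots> = (\<integral>\<^sup>+z. H (z / m) \<partial>exp_law)"
    by (subst nn_integral_density) auto
  finally show ?thesis
    by (simp add: mult_left_mono)
qed

text \<open>Inside the unit interval the avoided time interval has mass exactly t - s, and 1 - x <=
  exp (- x).\<close>

lemma emeasure_strip_law_gap:
  assumes "0 \<le> s" "s < t" "t \<le> 1"
  shows "emeasure strip_law {x. fst x \<notin> {s..t}} \<le> ennreal (exp (- (t - s)))"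
proof -
  interpret prob_space unit_uniform by (rule prob_space_unit_uniform)
  interpret S: prob_space strip_law by (rule prob_space_strip_law)
  have "{x \<in> space borel. fst x \<notin> {s..t}} \<in> sets (borel :: (real \<times> real) measure)"
    unfolding atLeastAtMost_iff by measurable
  then have m [measurable]: "{x. fst x \<notin> {s..t}} \<in> sets (borel :: (real \<times> real) measure)"
    by simp
  have "emeasure strip_law {x. fst x \<notin> {s..t}} = (\<integral>\<^sup>+x. indicator {x. fst x \<notin> {s..t}} x \<partial>strip_law)"
    by simp
  also have "\<dots> = (\<integral>\<^sup>+v. \<integral>\<^sup>+u. indicator {x. fst x \<notin> {s..t}} (v, u) \<partial>unit_uniform \<partial>unit_uniform)"
    by (rule nn_integral_strip_law) measurable
  also have "\<dots> = (\<integral>\<^sup>+v. indicator (- {s..t}) v \<partial>unit_uniform)"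
    by (simp add: indicator_def emeasure_space_1[unfolded space_uniform_measure, simplified])
  also have "\<dots> = emeasure unit_uniform (- {s..t})"
    by (rule nn_integral_indicator) auto
  also have "\<dots> = 1 - emeasure unit_uniform {s..t}"
  proof -
    have "emeasure unit_uniform (space unit_uniform - {s..t}) = emeasure unit_uniform (space unit_uniform) - emeasure unit_uniform {s..t}"
      by (rule emeasure_compl, simp) (simp only: infinity_ennreal_def emeasure_finite not_False_eq_True)
    then show ?thesis
      unfolding emeasure_space_1 by (simp only: space_uniform_measure space_lborel space_borel Compl_eq_Diff_UNIV)
  qed
  also have "emeasure unit_uniform {s..t} = ennreal (t - s)"
    using assms by (subst emeasure_uniform_measure) (auto simp: divide_ennreal_def)
  also have "1 - ennreal (t - s) = ennreal (1 - (t - s))"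
    using assms by (simp add: ennreal_minus flip: ennreal_1)
  also have "\<dots> \<le> ennreal (exp (- (t - s)))"
    using exp_ge_add_one_self[of "- (t - s)"] by (intro ennreal_leI) linarith
  finally show ?thesis .
qed


lemma prob_space_exp_law: "prob_space exp_law"
  by (rule prob_space_exponential_density) simp

text \<open>The expected ring length as an iterated extended integral, in the order in which the
  triple is traversed. In this form the integrals over the points lead to it directly and no
  integrability is required; \<open>nn_integral_ring_length\<close> later identifies it with an
  expectation.\<close>

definition limit_cost :: "real \<Rightarrow> real \<Rightarrow> ennreal" where
  "limit_cost \<alpha> h = (\<integral>\<^sup>+u0. \<integral>\<^sup>+z1. \<integral>\<^sup>+u1. \<integral>\<^sup>+z2. \<integral>\<^sup>+u2.
     ennreal (gap_cost \<alpha> (edge_length h) z1 z2 u0 u1 u2)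
     \<partial>unit_uniform \<partial>exp_law \<partial>unit_uniform \<partial>exp_law \<partial>unit_uniform)"

lemma gap_cost_edge_length_nonneg: "0 \<le> gap_cost \<alpha> (edge_length h) z1 z2 u0 u1 u2"
  by (simp add: gap_cost_def edge_length_def le_max_iff_disj)

lemma AE_unit_uniform: "AE t in unit_uniform. 0 \<le> t \<and> t \<le> 1"
  by (rule AE_uniform_measureI) auto

lemma AE_strip_law: "AE x in strip_law. 0 \<le> fst x \<and> fst x \<le> 1"
  unfolding strip_law_def
proof (rule pair_sigma_finite.AE_pair_measure)
  show "pair_sigma_finite unit_uniform unit_uniform"
    using prob_space_unit_uniform by (simp add: pair_sigma_finite_def prob_space_imp_sigma_finite)
  show "{x \<in> space (unit_uniform \<Otimes>\<^sub>M unit_uniform). 0 \<le> fst x \<and> fst x \<le> 1} \<in> sets (unit_uniform \<Otimes>\<^sub>M unit_uniform)"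
    by measurable
  show "AE x in unit_uniform. AE y in unit_uniform. 0 \<le> fst (x, y) \<and> fst (x, y) \<le> 1"
    using AE_unit_uniform by eventually_elim simp
qed

text \<open>The times of \<open>c\<close> and then of \<open>b\<close> are integrated out, each at
  the price of a factor 1 / m, while the time of \<open>a\<close> has total mass one. Rescaling the
  lengths gives K / m, hence K / m^3 altogether.\<close>

lemma nn_integral_gaps_le:
  assumes K: "0 < K" and m: "0 < m" and h: "sqrt m / K \<le> h" and \<alpha>: "1 \<le> \<alpha>"
  shows "(\<integral>\<^sup>+a. \<integral>\<^sup>+b. \<integral>\<^sup>+c. (if fst a < fst b \<and> fst b < fst c
        then ennreal (strip_cost \<alpha> K a b c) * emeasure strip_law {x \<in> space strip_law. fst x \<notin> {fst a..fst c}} ^ m else 0)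
        \<partial>strip_law \<partial>strip_law \<partial>strip_law)
    \<le> ennreal (K / real m ^ 3) * limit_cost \<alpha> h"
proof -
  interpret U: prob_space unit_uniform by (rule prob_space_unit_uniform)
  interpret E: prob_space exp_law by (rule prob_space_exp_law)
  \<comment> \<open>Measurability of the iterated integrals is read in the product sigma-algebra
    instead of the Borel sets of the plane.\<close>
  have [measurable_cong]: "sets strip_law = sets (unit_uniform \<Otimes>\<^sub>M unit_uniform)"
    by (simp only: strip_law_def)
  note sets_strip_law [measurable_cong del]
  have split: "(\<integral>\<^sup>+x. f x \<partial>strip_law) = (\<integral>\<^sup>+t. \<integral>\<^sup>+u. f (t, u) \<partial>unit_uniform \<partial>unit_uniform)"
    if "f \<in> borel_measurable strip_law" for f
    using that unfolding strip_law_def by (rule U.nn_integral_fst[symmetric])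
  define e where "e p = ennreal (exp (- real m * p))" for p
  have [measurable]: "e \<in> borel_measurable borel"
    unfolding e_def by measurable
  define G where "G p q u0 u1 u2 = ennreal (gap_cost \<alpha> (strip_dist K) p q u0 u1 u2)" for p q u0 u1 u2
  have [measurable (raw)]: "(\<lambda>x. G (z1 x) (z2 x) (u0 x) (u1 x) (u2 x)) \<in> borel_measurable M"
    if [measurable]: "z1 \<in> borel_measurable M" "z2 \<in> borel_measurable M" "u0 \<in> borel_measurable M"
    "u1 \<in> borel_measurable M" "u2 \<in> borel_measurable M" for z1 z2 u0 u1 u2 and M :: "'x measure"
    unfolding G_def by measurable
  \<comment> \<open>The avoidance probability is replaced by its exponential bound, which factors
    over the two gaps so that they can be integrated one after the other.\<close>
  let ?W = "\<lambda>a b c. if fst a < fst b \<and> fst b < fst c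
      then G (fst b - fst a) (fst c - fst b) (snd a) (snd b) (snd c) * e (fst c - fst b) * e (fst b - fst a) else 0"
  let ?I1 = "\<lambda>p u0 u1. \<integral>\<^sup>+z2. \<integral>\<^sup>+u2. G p (z2 / m) u0 u1 u2 \<partial>unit_uniform \<partial>exp_law"
  let ?W2 = "\<lambda>a b. if fst a < fst b then ennreal (1 / m) * ?I1 (fst b - fst a) (snd a) (snd b) * e (fst b - fst a) else 0"
  have W2: "(\<integral>\<^sup>+c. ?W a b c \<partial>strip_law) \<le> ?W2 a b" for a b
  proof (cases "fst a < fst b")
    case True
    have "(\<integral>\<^sup>+c. ?W a b c \<partial>strip_law) = (\<integral>\<^sup>+t. \<integral>\<^sup>+u. ?W a b (t, u) \<partial>unit_uniform \<partial>unit_uniform)"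
      by (rule split) measurable
    also have "\<dots> = (\<integral>\<^sup>+t. \<integral>\<^sup>+u. (if fst b < t then e (t - fst b) * e (fst b - fst a) else 0)
        * G (fst b - fst a) (t - fst b) (snd a) (snd b) u \<partial>unit_uniform \<partial>unit_uniform)"
      using True by (intro nn_integral_cong) (simp add: mult_ac)
    also have "\<dots> = (\<integral>\<^sup>+t. (if fst b < t then e (t - fst b) * e (fst b - fst a) else 0)
        * (\<integral>\<^sup>+u. G (fst b - fst a) (t - fst b) (snd a) (snd b) u \<partial>unit_uniform) \<partial>unit_uniform)"
      by (intro nn_integral_cong nn_integral_cmult) measurable
    also have "\<dots> = (\<integral>\<^sup>+t. (if fst b < t then (\<integral>\<^sup>+u. G (fst b - fst a) (t - fst b) (snd a) (snd b) u \<partial>unit_uniform)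
        * e (t - fst b) else 0) * e (fst b - fst a) \<partial>unit_uniform)"
      by (intro nn_integral_cong) (simp add: mult_ac)
    also have "\<dots> = (\<integral>\<^sup>+t. (if fst b < t then (\<integral>\<^sup>+u. G (fst b - fst a) (t - fst b) (snd a) (snd b) u \<partial>unit_uniform)
        * e (t - fst b) else 0) \<partial>unit_uniform) * e (fst b - fst a)"
      by (rule nn_integral_multc) measurable
    also have "\<dots> \<le> (ennreal (1 / m) * ?I1 (fst b - fst a) (snd a) (snd b)) * e (fst b - fst a)"
      unfolding e_def using m by (intro mult_right_mono nn_integral_gap_le) (simp_all, measurable)
    finally show ?thesis using True by simp
  qed simp
  let ?I2 = "\<lambda>u0. \<integral>\<^sup>+z1. \<integral>\<^sup>+u1. ?I1 (z1 / m) u0 u1 \<partial>unit_uniform \<partial>exp_law"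
  have W3: "(\<integral>\<^sup>+b. ?W2 a b \<partial>strip_law) \<le> ennreal (1 / m) * (ennreal (1 / m) * ?I2 (snd a))" for a
  proof -
    have "(\<integral>\<^sup>+b. ?W2 a b \<partial>strip_law) = (\<integral>\<^sup>+t. \<integral>\<^sup>+u. ?W2 a (t, u) \<partial>unit_uniform \<partial>unit_uniform)"
      by (rule split) measurable
    also have "\<dots> = (\<integral>\<^sup>+t. \<integral>\<^sup>+u. ennreal (1 / m) * (if fst a < t then e (t - fst a) else 0)
        * ?I1 (t - fst a) (snd a) u \<partial>unit_uniform \<partial>unit_uniform)"
      by (intro nn_integral_cong) (simp add: mult_ac)
    also have "\<dots> = (\<integral>\<^sup>+t. ennreal (1 / m) * (if fst a < t then e (t - fst a) else 0)
        * (\<integral>\<^sup>+u. ?I1 (t - fst a) (snd a) u \<partial>unit_uniform) \<partial>unit_uniform)"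
      by (intro nn_integral_cong nn_integral_cmult) measurable
    also have "\<dots> = (\<integral>\<^sup>+t. ennreal (1 / m) * (if fst a < t then (\<integral>\<^sup>+u. ?I1 (t - fst a) (snd a) u \<partial>unit_uniform)
        * e (t - fst a) else 0) \<partial>unit_uniform)"
      by (intro nn_integral_cong) (simp add: mult_ac)
    also have "\<dots> = ennreal (1 / m) * (\<integral>\<^sup>+t. (if fst a < t then (\<integral>\<^sup>+u. ?I1 (t - fst a) (snd a) u \<partial>unit_uniform)
        * e (t - fst a) else 0) \<partial>unit_uniform)"
      by (rule nn_integral_cmult) measurable
    also have "\<dots> \<le> ennreal (1 / m) * (ennreal (1 / m) * ?I2 (snd a))"
      unfolding e_def using m by (intro mult_left_mono nn_integral_gap_le) (simp_all, measurable)
    finally show ?thesis .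
  qed
  \<comment> \<open>Here \<open>sqrt m / K \<le> h\<close> enters: the edge lengths increase with
    the parameter.\<close>
  have cost: "G (z1 / m) (z2 / m) u0 u1 u2 \<le> ennreal (K / m) * ennreal (gap_cost \<alpha> (edge_length h) z1 z2 u0 u1 u2)" for z1 z2 u0 u1 u2
  proof -
    have "strip_dist K (z / m) v \<le> K / m * edge_length h z v" for z v
      using strip_dist_rescale[of K m z v] edge_length_mono[of "sqrt m / K" h z v] K m h
      by (simp add: divide_right_mono mult_left_mono)
    then have "gap_cost \<alpha> (strip_dist K) (z1 / m) (z2 / m) u0 u1 u2
        \<le> K / m * gap_cost \<alpha> (edge_length h) z1 z2 u0 u1 u2"
      using \<alpha> by (intro gap_cost_le) auto
    then show ?thesis
      unfolding G_def using gap_cost_edge_length_nonneg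
      by (simp add: ennreal_leI flip: ennreal_mult)
  qed
  have "(\<integral>\<^sup>+a. \<integral>\<^sup>+b. \<integral>\<^sup>+c. (if fst a < fst b \<and> fst b < fst c
        then ennreal (strip_cost \<alpha> K a b c) * emeasure strip_law {x \<in> space strip_law. fst x \<notin> {fst a..fst c}} ^ m else 0)
        \<partial>strip_law \<partial>strip_law \<partial>strip_law) \<le> (\<integral>\<^sup>+a. \<integral>\<^sup>+b. \<integral>\<^sup>+c. ?W a b c \<partial>strip_law \<partial>strip_law \<partial>strip_law)"
  proof (rule nn_integral_mono_AE, use AE_strip_law in eventually_elim, rule nn_integral_mono,
      rule nn_integral_mono_AE, use AE_strip_law in eventually_elim)
    \<comment> \<open>Almost surely \<open>a\<close> and \<open>c\<close> have times in the unit
      interval, as the gap estimate requires; this suffices because \<open>b\<close> lies between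
      them.\<close>
    fix a b c :: "real \<times> real"
    assume a: "0 \<le> fst a \<and> fst a \<le> 1" and c: "0 \<le> fst c \<and> fst c \<le> 1"
    have "emeasure strip_law {x. fst x \<notin> {fst a..fst c}} ^ m \<le> e (fst c - fst b) * e (fst b - fst a)"
      if "fst a < fst b" "fst b < fst c"
    proof -
      have "emeasure strip_law {x. fst x \<notin> {fst a..fst c}} ^ m \<le> ennreal (exp (- (fst c - fst a))) ^ m"
        using a c that by (intro power_mono_ennreal emeasure_strip_law_gap) auto
      also have "\<dots> = ennreal (exp (- real m * (fst c - fst a)))"
        by (simp add: ennreal_power exp_of_nat_mult[symmetric] right_diff_distrib)
      also have "\<dots> = e (fst c - fst b) * e (fst b - fst a)"
        by (simp add: e_def ennreal_mult[symmetric] exp_add[symmetric] algebra_simps)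
      finally show ?thesis .
    qed
    then show "(if fst a < fst b \<and> fst b < fst c
        then ennreal (strip_cost \<alpha> K a b c) * emeasure strip_law {x \<in> space strip_law. fst x \<notin> {fst a..fst c}} ^ m else 0)
      \<le> ?W a b c"
      by (auto simp: G_def strip_cost_def mult.assoc simp del: atLeastAtMost_iff intro!: mult_left_mono)
  qed
  also have "\<dots> \<le> (\<integral>\<^sup>+a. \<integral>\<^sup>+b. ?W2 a b \<partial>strip_law \<partial>strip_law)"
    by (intro nn_integral_mono W2)
  also have "\<dots> \<le> (\<integral>\<^sup>+a. ennreal (1 / m) * (ennreal (1 / m) * ?I2 (snd a)) \<partial>strip_law)"
    by (intro nn_integral_mono W3)
  also have "\<dots> = (\<integral>\<^sup>+t. \<integral>\<^sup>+u0. ennreal (1 / m) * (ennreal (1 / m) * ?I2 (snd (t, u0))) \<partial>unit_uniform \<partial>unit_uniform)"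
    by (rule split) measurable
  also have "\<dots> = (\<integral>\<^sup>+u0. ennreal (1 / m) * (ennreal (1 / m) * ?I2 u0) \<partial>unit_uniform)"
    using U.emeasure_space_1 by simp
  also have "\<dots> \<le> (\<integral>\<^sup>+u0. ennreal (1 / m) * (ennreal (1 / m) * (\<integral>\<^sup>+z1. \<integral>\<^sup>+u1. \<integral>\<^sup>+z2. \<integral>\<^sup>+u2.
     ennreal (K / m) * ennreal (gap_cost \<alpha> (edge_length h) z1 z2 u0 u1 u2)
     \<partial>unit_uniform \<partial>exp_law \<partial>unit_uniform \<partial>exp_law)) \<partial>unit_uniform)"
    by (intro nn_integral_mono mult_left_mono cost) auto
  also have "\<dots> = ennreal (1 / m) * (ennreal (1 / m) * (ennreal (K / m) * limit_cost \<alpha> h))"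
    unfolding limit_cost_def by (simp add: nn_integral_cmult)
  also have "\<dots> = ennreal (K / real m ^ 3) * limit_cost \<alpha> h"
  proof -
    have "ennreal (1 / m) * (ennreal (1 / m) * ennreal (K / m)) = ennreal (K / real m ^ 3)"
      by (simp add: power3_eq_cube flip: ennreal_mult)
    then show ?thesis by (simp add: mult.assoc[symmetric])
  qed
  finally show ?thesis .
qed


subsection \<open>The expected tour length\<close>

lemma consecutive_cong:
  assumes "\<And>l. l \<in> I \<Longrightarrow> s l = t l" "i \<in> I" "j \<in> I" "k \<in> I"
  shows "consecutive I s i j k \<longleftrightarrow> consecutive I t i j k"
  using assms by (simp add: consecutive_def)

lemma (in prob_space) indep_var_of_indep_vars:
  assumes "indep_vars M' X I" "i \<in> I" "j \<in> I" "i \<noteq> j"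
  shows "indep_var (M' i) (X i) (M' j) (X j)"
proof -
  have "indep_var (PiM {i} M') (\<lambda>\<omega>. restrict (\<lambda>i. X i \<omega>) {i}) (PiM {j} M') (\<lambda>\<omega>. restrict (\<lambda>i. X i \<omega>) {j})"
    using assms by (intro indep_var_restrict) auto
  then have "indep_var (M' i) ((\<lambda>f. f i) \<circ> (\<lambda>\<omega>. restrict (\<lambda>i. X i \<omega>) {i}))
      (M' j) ((\<lambda>f. f j) \<circ> (\<lambda>\<omega>. restrict (\<lambda>i. X i \<omega>) {j}))"
    by (rule indep_var_compose) (auto intro: measurable_component_singleton)
  then show ?thesis
    by (simp add: o_def)
qed

locale uniform_points = prob_space M for M :: "'a measure" +
  fixes X :: "nat \<Rightarrow> 'a \<Rightarrow> point"
  assumes indep: "indep_vars (\<lambda>_. borel) X UNIV"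
    and distr_X: "\<And>i. distr M borel (X i) = uniform_measure lborel (cbox 0 1)"
begin

lemma measurable_X [measurable]: "X i \<in> borel_measurable M"
  using indep by (simp add: indep_vars_def)

lemma AE_unit_square: "AE \<omega> in M. X i \<omega> \<in> cbox 0 1"
proof -
  have "AE p in distr M borel (X i). p \<in> cbox 0 1"
    unfolding distr_X by (rule AE_uniform_measureI) auto
  then show ?thesis
    by (subst (asm) AE_distr_iff) auto
qed

lemma distr_strip_coords_X:
  assumes "0 < K"
  shows "distr M borel (\<lambda>\<omega>. strip_coords K (X i \<omega>)) = strip_law"
proof -
  have "distr (distr M borel (X i)) borel (strip_coords K) = distr M borel (strip_coords K \<circ> X i)"
    by (rule distr_distr) measurable
  then show ?thesis
    using distr_strip_coords[OF assms] by (simp add: distr_X o_def)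
qed

lemma indep_strip_coords:
  "indep_vars (\<lambda>_. borel) (\<lambda>i \<omega>. strip_coords K (X i \<omega>)) I"
  by (rule indep_vars_compose2[OF indep_vars_subset[OF indep]]) auto

text \<open>The two times are independent with a law free of atoms, so ties are null. This supplies
  the injectivity needed for the strip order.\<close>

lemma AE_strip_time_neq:
  assumes "0 < K" "i \<noteq> j"
  shows "AE \<omega> in M. fst (strip_coords K (X i \<omega>)) \<noteq> fst (strip_coords K (X j \<omega>))"
proof -
  let ?Y = "\<lambda>i \<omega>. strip_coords K (X i \<omega>)"
  have "indep_var borel (?Y i) borel (?Y j)"
    using indep_var_of_indep_vars[OF indep_strip_coords[of K UNIV], of i j] assms by simp
  then have joint: "distr M (borel \<Otimes>\<^sub>M borel) (\<lambda>\<omega>. (?Y i \<omega>, ?Y j \<omega>)) = strip_law \<Otimes>\<^sub>M strip_law"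
    using distr_strip_coords_X[OF assms(1)] by (simp add: indep_var_distribution_eq)
  have sf: "sigma_finite_measure unit_uniform" "sigma_finite_measure strip_law"
    using prob_space_unit_uniform prob_space_strip_law by (simp_all add: prob_space_imp_sigma_finite)
  have uni: "AE t in unit_uniform. s \<noteq> t" for s :: real
    using AE_lborel_singleton[of s] by (intro AE_uniform_measureI) (auto elim!: eventually_mono)
  have *: "{x \<in> space (strip_law \<Otimes>\<^sub>M strip_law). fst (fst x) \<noteq> fst (snd x)} \<in> sets (strip_law \<Otimes>\<^sub>M strip_law)"
    unfolding strip_law_def by measurable
  have "AE x in strip_law \<Otimes>\<^sub>M strip_law. fst (fst x) \<noteq> fst (snd x)"
  proof (rule pair_sigma_finite.AE_pair_measure[OF _ *])
    show "pair_sigma_finite strip_law strip_law"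
      using sf by (simp add: pair_sigma_finite_def)
    have "AE y in strip_law. s \<noteq> fst y" for s
      unfolding strip_law_def
    proof (rule pair_sigma_finite.AE_pair_measure)
      show "pair_sigma_finite unit_uniform unit_uniform"
        using sf by (simp add: pair_sigma_finite_def)
      show "{x \<in> space (unit_uniform \<Otimes>\<^sub>M unit_uniform). s \<noteq> fst x} \<in> sets (unit_uniform \<Otimes>\<^sub>M unit_uniform)"
        by measurable
      show "AE x in unit_uniform. AE y in unit_uniform. s \<noteq> fst (x, y)"
        using uni[of s] by eventually_elim simp
    qed
    then show "AE x in strip_law. AE y in strip_law. fst (fst (x, y)) \<noteq> fst (snd (x, y))"
      by simp
  qed
  then have "AE x in distr M (borel \<Otimes>\<^sub>M borel) (\<lambda>\<omega>. (?Y i \<omega>, ?Y j \<omega>)). fst (fst x) \<noteq> fst (snd x)"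
    by (simp only: joint)
  note AE_joint = this
  have "(\<lambda>\<omega>. (?Y i \<omega>, ?Y j \<omega>)) \<in> measurable M (borel \<Otimes>\<^sub>M borel)"
    by (intro measurable_Pair measurable_compose[OF measurable_X measurable_strip_coords])
  from AE_distrD[OF this AE_joint] show ?thesis
    by (simp only: fst_conv snd_conv)
qed

lemma measurable_consecutive_cost:
  assumes "finite I" "i \<in> I" "j \<in> I" "k \<in> I"
  shows "(\<lambda>y. if consecutive I (\<lambda>l. fst (y l)) i j k then ennreal (strip_cost \<alpha> K (y i) (y j) (y k)) else 0)
    \<in> borel_measurable (PiM I (\<lambda>_. borel))"
proof -
  let ?g = "\<lambda>x. ennreal (strip_cost \<alpha> K (fst x) (fst (snd x)) (snd (snd x)))"
  have "?g \<in> borel_measurable (borel \<Otimes>\<^sub>M borel \<Otimes>\<^sub>M borel)"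
    by measurable
  from measurable_consecutive[OF measurable_fst_plane this assms] show ?thesis
    by (simp cong: if_cong)
qed

text \<open>The bound is the same for all index triples, since the coordinates are independent with
  common law \<open>strip_law\<close>. Triples with a repeated index cannot be consecutive, because
  the inequalities are strict, so they contribute nothing.\<close>

lemma nn_integral_consecutive_le:
  assumes I: "finite I" "i \<in> I" "j \<in> I" "k \<in> I"
    and K: "0 < K" and m: "0 < m" "card I = m + 3" and h: "sqrt m / K \<le> h" and \<alpha>: "1 \<le> \<alpha>"
  shows "(\<integral>\<^sup>+\<omega>. (if consecutive I (\<lambda>l. fst (strip_coords K (X l \<omega>))) i j k
      then ennreal (strip_cost \<alpha> K (strip_coords K (X i \<omega>)) (strip_coords K (X j \<omega>)) (strip_coords K (X k \<omega>))) else 0) \<partial>M)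
    \<le> ennreal (K / real m ^ 3) * limit_cost \<alpha> h"
proof (cases "i \<noteq> j \<and> i \<noteq> k \<and> j \<noteq> k")
  case True
  let ?Y = "\<lambda>i \<omega>. strip_coords K (X i \<omega>)"
  let ?f = "\<lambda>y. if consecutive I (\<lambda>l. fst (y l)) i j k then ennreal (strip_cost \<alpha> K (y i) (y j) (y k)) else 0"
  let ?g = "\<lambda>x. ennreal (strip_cost \<alpha> K (fst x) (fst (snd x)) (snd (snd x)))"
  have joint: "distr M (PiM I (\<lambda>_. borel)) (\<lambda>\<omega>. \<lambda>i\<in>I. ?Y i \<omega>) = PiM I (\<lambda>_. strip_law)"
  proof -
    have "distr M (PiM I (\<lambda>_. borel)) (\<lambda>\<omega>. \<lambda>i\<in>I. ?Y i \<omega>) = PiM I (\<lambda>i. distr M borel (?Y i))"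
      by (rule indep_vars_iff_distr_eq_PiM'[THEN iffD1, OF _ _ indep_strip_coords]) (use I in auto)
    then show ?thesis by (simp add: distr_strip_coords_X[OF K])
  qed
  have "(\<integral>\<^sup>+\<omega>. (if consecutive I (\<lambda>l. fst (?Y l \<omega>)) i j k then ennreal (strip_cost \<alpha> K (?Y i \<omega>) (?Y j \<omega>) (?Y k \<omega>)) else 0) \<partial>M)
    = (\<integral>\<^sup>+\<omega>. ?f (\<lambda>i\<in>I. ?Y i \<omega>) \<partial>M)"
  proof -
    have "consecutive I (\<lambda>l. fst (restrict (\<lambda>i. ?Y i \<omega>) I l)) i j k \<longleftrightarrow> consecutive I (\<lambda>l. fst (?Y l \<omega>)) i j k" for \<omega>
      using I by (intro consecutive_cong) auto
    then show ?thesis using I by (simp cong: if_cong)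
  qed
  also have "\<dots> = (\<integral>\<^sup>+y. ?f y \<partial>distr M (PiM I (\<lambda>_. borel)) (\<lambda>\<omega>. \<lambda>i\<in>I. ?Y i \<omega>))"
    using measurable_consecutive_cost[OF I]
    by (intro nn_integral_distr[symmetric] measurable_restrict) auto
  also have "\<dots> = (\<integral>\<^sup>+y. (if consecutive I (\<lambda>l. fst (y l)) i j k then ?g (y i, y j, y k) else 0) \<partial>PiM I (\<lambda>_. strip_law))"
    by (simp add: joint cong: if_cong)
  also have "\<dots> = (\<integral>\<^sup>+a. \<integral>\<^sup>+b. \<integral>\<^sup>+c. (if fst a < fst b \<and> fst b < fst c
        then ?g (a, b, c) * emeasure strip_law {x \<in> space strip_law. fst x \<notin> {fst a..fst c}} ^ (card I - 3) else 0)
        \<partial>strip_law \<partial>strip_law \<partial>strip_law)"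
  proof (rule nn_integral_consecutive_triple[OF prob_space_strip_law])
    show "fst \<in> borel_measurable strip_law"
      using measurable_fst_plane measurable_cong_sets[OF sets_strip_law refl] by blast
    have "sets (strip_law \<Otimes>\<^sub>M strip_law \<Otimes>\<^sub>M strip_law)
        = sets ((borel :: (real \<times> real) measure) \<Otimes>\<^sub>M (borel :: (real \<times> real) measure) \<Otimes>\<^sub>M (borel :: (real \<times> real) measure))"
      by (intro sets_pair_measure_cong sets_strip_law)
    moreover have "?g \<in> borel_measurable (borel \<Otimes>\<^sub>M borel \<Otimes>\<^sub>M borel)"
      by measurable
    ultimately show "?g \<in> borel_measurable (strip_law \<Otimes>\<^sub>M strip_law \<Otimes>\<^sub>M strip_law)"
      using measurable_cong_sets[OF _ refl] by blast
  qed (use I True in auto)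
  also have "\<dots> \<le> ennreal (K / real m ^ 3) * limit_cost \<alpha> h"
    using nn_integral_gaps_le[OF K m(1) h \<alpha>]
    by (simp only: fst_conv snd_conv m(2) add_diff_cancel_right')
  finally show ?thesis .
next
  case False
  then have "\<not> consecutive I t i j k" for t
    by (auto simp: consecutive_def)
  then show ?thesis by simp
qed

text \<open>The cost need not be measurable here: a function that is not integrable has integral \<open>0\<close>.\<close>

lemma expectation_TSPD_le:
  fixes K m n :: nat
  assumes K: "0 < K" and m: "0 < m" "n = m + 3" and h: "sqrt m / K \<le> h" and \<alpha>: "1 \<le> \<alpha>"
    and r: "limit_cost \<alpha> h \<le> ennreal r" "0 \<le> r"
  shows "(\<integral>\<omega>. euclidean_TSPD \<alpha> ((\<lambda>i. X i \<omega>) ` {..<n}) \<partial>M)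
    \<le> real n ^ 3 * K * r / (2 * real m ^ 3) + (1 + 2 * sqrt 2)"
proof (rule integral_real_bounded)
  let ?I = "{..<n}"
  let ?Y = "\<lambda>i \<omega>. strip_coords K (X i \<omega>)"
  let ?f = "\<lambda>(i, j, k) \<omega>. if consecutive ?I (\<lambda>l. fst (?Y l \<omega>)) i j k then strip_cost \<alpha> K (?Y i \<omega>) (?Y j \<omega>) (?Y k \<omega>) else 0"
  let ?g = "\<lambda>(i, j, k) \<omega>. if consecutive ?I (\<lambda>l. fst (?Y l \<omega>)) i j k then ennreal (strip_cost \<alpha> K (?Y i \<omega>) (?Y j \<omega>) (?Y k \<omega>)) else 0"
  have gf: "?g x \<omega> = ennreal (?f x \<omega>)" "0 \<le> ?f x \<omega>" for x \<omega>
    using strip_cost_nonneg[OF \<alpha>] by (simp_all add: case_prod_beta)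
  have meas: "?g x \<in> borel_measurable M" if "x \<in> ?I \<times> ?I \<times> ?I" for x
  proof -
    obtain i j k where ijk: "x = (i, j, k)"
      by (cases x)
    with that have x: "x = (i, j, k)" "i < n" "j < n" "k < n"
      by auto
    have "(\<lambda>\<omega>. \<lambda>i\<in>?I. ?Y i \<omega>) \<in> measurable M (PiM ?I (\<lambda>_. borel))"
      by (intro measurable_restrict) auto
    from measurable_compose[OF this measurable_consecutive_cost[of ?I i j k \<alpha> K]]
    have "(\<lambda>\<omega>. if consecutive ?I (\<lambda>l. fst (restrict (\<lambda>i. ?Y i \<omega>) ?I l)) i j k
        then ennreal (strip_cost \<alpha> K (?Y i \<omega>) (?Y j \<omega>) (?Y k \<omega>)) else 0) \<in> borel_measurable M"
      using x by (simp cong: if_cong)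
    moreover have "consecutive ?I (\<lambda>l. fst (restrict (\<lambda>i. ?Y i \<omega>) ?I l)) i j k \<longleftrightarrow> consecutive ?I (\<lambda>l. fst (?Y l \<omega>)) i j k" for \<omega>
      using x by (intro consecutive_cong) auto
    ultimately show ?thesis
      using x by (simp cong: if_cong)
  qed
  have meas_sum: "(\<lambda>\<omega>. \<Sum>x\<in>?I \<times> ?I \<times> ?I. ?g x \<omega>) \<in> borel_measurable M"
    by (rule borel_measurable_sum) (rule meas)
  have sum_le: "(\<Sum>x\<in>?I \<times> ?I \<times> ?I. \<integral>\<^sup>+\<omega>. ?g x \<omega> \<partial>M) \<le> of_nat (card (?I \<times> ?I \<times> ?I)) * ennreal (K / real m ^ 3 * r)"
  proof (rule sum_bounded_above)
    fix x assume "x \<in> ?I \<times> ?I \<times> ?I"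
    moreover obtain i j k where "x = (i, j, k)"
      by (cases x)
    ultimately have x: "x = (i, j, k)" "i < n" "j < n" "k < n"
      by auto
    have "(\<integral>\<^sup>+\<omega>. ?g x \<omega> \<partial>M) \<le> ennreal (K / real m ^ 3) * limit_cost \<alpha> h"
      using nn_integral_consecutive_le[of ?I i j k K m h \<alpha>] x K m h \<alpha> by simp
    also have "\<dots> \<le> ennreal (K / real m ^ 3) * ennreal r"
      using r by (intro mult_left_mono) auto
    also have "\<dots> = ennreal (K / real m ^ 3 * r)"
      by (rule ennreal_mult[symmetric]) (use r in auto)
    finally show "(\<integral>\<^sup>+\<omega>. ?g x \<omega> \<partial>M) \<le> ennreal (K / real m ^ 3 * r)" .
  qed
  have "AE \<omega> in M. \<forall>i\<in>?I. X i \<omega> \<in> cbox 0 1"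
    by (intro AE_finite_allI AE_unit_square) auto
  moreover have "AE \<omega> in M. \<forall>x\<in>{(i, j) \<in> ?I \<times> ?I. i \<noteq> j}. fst (?Y (fst x) \<omega>) \<noteq> fst (?Y (snd x) \<omega>)"
  proof (rule AE_finite_allI)
    show "finite {(i, j) \<in> ?I \<times> ?I. i \<noteq> j}"
      by (rule finite_subset[of _ "?I \<times> ?I"]) auto
    fix x assume "x \<in> {(i, j) \<in> ?I \<times> ?I. i \<noteq> j}"
    then have "fst x \<noteq> snd x" by auto
    then show "AE \<omega> in M. fst (?Y (fst x) \<omega>) \<noteq> fst (?Y (snd x) \<omega>)"
      by (rule AE_strip_time_neq[OF K])
  qed
  \<comment> \<open>Outside two null events, a point off the closed square or a tie of passing
    times, the deterministic bound applies pathwise.\<close>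
  ultimately have "AE \<omega> in M. ennreal (euclidean_TSPD \<alpha> ((\<lambda>i. X i \<omega>) ` ?I))
      \<le> ennreal (1 / 2) * (\<Sum>x\<in>?I \<times> ?I \<times> ?I. ?g x \<omega>) + ennreal (1 + 2 * sqrt 2)"
  proof eventually_elim
    case (elim \<omega>)
    have "inj_on (\<lambda>i. strip_time K (X i \<omega>)) ?I"
    proof (rule inj_onI, rule ccontr)
      fix i j assume "i \<in> ?I" "j \<in> ?I" "strip_time K (X i \<omega>) = strip_time K (X j \<omega>)" "i \<noteq> j"
      then show False
        using bspec[OF elim(2), of "(i, j)"] by (simp add: strip_coords_def)
    qed
    moreover have "(\<lambda>(i, j, k). if consecutive ?I (\<lambda>l. fst (?Y l \<omega>)) i j k then strip_cost \<alpha> K (?Y i \<omega>) (?Y j \<omega>) (?Y k \<omega>) else 0)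
        = (\<lambda>x. ?f x \<omega>)"
      by (rule ext) (simp only: case_prod_beta)
    ultimately have "euclidean_TSPD \<alpha> ((\<lambda>i. X i \<omega>) ` ?I) \<le> (\<Sum>x\<in>?I \<times> ?I \<times> ?I. ?f x \<omega>) / 2 + (1 + 2 * sqrt 2)"
      using euclidean_TSPD_le_consecutive[of ?I "\<lambda>i. X i \<omega>" K \<alpha>, OF _ _ bspec[OF elim(1)] _ K \<alpha>] m
      by (simp only: finite_lessThan card_lessThan)
    then have "ennreal (euclidean_TSPD \<alpha> ((\<lambda>i. X i \<omega>) ` ?I)) \<le> ennreal (1 / 2 * (\<Sum>x\<in>?I \<times> ?I \<times> ?I. ?f x \<omega>) + (1 + 2 * sqrt 2))"
      by (intro ennreal_leI) linarith
    also have "\<dots> = ennreal (1 / 2 * (\<Sum>x\<in>?I \<times> ?I \<times> ?I. ?f x \<omega>)) + ennreal (1 + 2 * sqrt 2)"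
      by (intro ennreal_plus mult_nonneg_nonneg sum_nonneg gf) simp_all
    also have "ennreal (1 / 2 * (\<Sum>x\<in>?I \<times> ?I \<times> ?I. ?f x \<omega>)) = ennreal (1 / 2) * ennreal (\<Sum>x\<in>?I \<times> ?I \<times> ?I. ?f x \<omega>)"
      by (intro ennreal_mult sum_nonneg gf) simp
    also have "ennreal (\<Sum>x\<in>?I \<times> ?I \<times> ?I. ?f x \<omega>) = (\<Sum>x\<in>?I \<times> ?I \<times> ?I. ?g x \<omega>)"
      unfolding gf(1) by (rule sum_ennreal[symmetric]) (rule gf(2))
    finally show ?case .
  qed
  then have "(\<integral>\<^sup>+\<omega>. ennreal (euclidean_TSPD \<alpha> ((\<lambda>i. X i \<omega>) ` ?I)) \<partial>M)
      \<le> (\<integral>\<^sup>+\<omega>. ennreal (1 / 2) * (\<Sum>x\<in>?I \<times> ?I \<times> ?I. ?g x \<omega>) + ennreal (1 + 2 * sqrt 2) \<partial>M)"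
    by (rule nn_integral_mono_AE)
  also have "\<dots> = (\<integral>\<^sup>+\<omega>. ennreal (1 / 2) * (\<Sum>x\<in>?I \<times> ?I \<times> ?I. ?g x \<omega>) \<partial>M) + (\<integral>\<^sup>+\<omega>. ennreal (1 + 2 * sqrt 2) \<partial>M)"
    using meas_sum by (intro nn_integral_add) simp_all
  also have "(\<integral>\<^sup>+\<omega>. ennreal (1 / 2) * (\<Sum>x\<in>?I \<times> ?I \<times> ?I. ?g x \<omega>) \<partial>M)
      = ennreal (1 / 2) * (\<integral>\<^sup>+\<omega>. (\<Sum>x\<in>?I \<times> ?I \<times> ?I. ?g x \<omega>) \<partial>M)"
    using meas_sum by (rule nn_integral_cmult)
  also have "(\<integral>\<^sup>+\<omega>. (\<Sum>x\<in>?I \<times> ?I \<times> ?I. ?g x \<omega>) \<partial>M) = (\<Sum>x\<in>?I \<times> ?I \<times> ?I. \<integral>\<^sup>+\<omega>. ?g x \<omega> \<partial>M)"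
    by (rule nn_integral_sum) (rule meas)
  also have "ennreal (1 / 2) * (\<Sum>x\<in>?I \<times> ?I \<times> ?I. \<integral>\<^sup>+\<omega>. ?g x \<omega> \<partial>M) + (\<integral>\<^sup>+\<omega>. ennreal (1 + 2 * sqrt 2) \<partial>M)
    \<le> ennreal (1 / 2) * (of_nat (card (?I \<times> ?I \<times> ?I)) * ennreal (K / real m ^ 3 * r)) + ennreal (1 + 2 * sqrt 2)"
  proof (rule add_mono)
    show "ennreal (1 / 2) * (\<Sum>x\<in>?I \<times> ?I \<times> ?I. \<integral>\<^sup>+\<omega>. ?g x \<omega> \<partial>M)
        \<le> ennreal (1 / 2) * (of_nat (card (?I \<times> ?I \<times> ?I)) * ennreal (K / real m ^ 3 * r))"
      by (rule mult_left_mono[OF sum_le]) simp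
  qed (simp add: emeasure_space_1)
  also have "\<dots> = ennreal (1 / 2 * (real n ^ 3 * (K / real m ^ 3 * r)) + (1 + 2 * sqrt 2))"
  proof -
    have "of_nat (card (?I \<times> ?I \<times> ?I)) = ennreal (real n ^ 3)"
      by (simp add: ennreal_of_nat_eq_real_of_nat power3_eq_cube)
    moreover have "ennreal (real n ^ 3) * ennreal (K / real m ^ 3 * r) = ennreal (real n ^ 3 * (K / real m ^ 3 * r))"
      by (rule ennreal_mult[symmetric]) (use r in auto)
    moreover have "ennreal (1 / 2) * ennreal (real n ^ 3 * (K / real m ^ 3 * r)) = ennreal (1 / 2 * (real n ^ 3 * (K / real m ^ 3 * r)))"
      by (rule ennreal_mult[symmetric]) (use r in auto)
    moreover have "ennreal (1 / 2 * (real n ^ 3 * (K / real m ^ 3 * r))) + ennreal (1 + 2 * sqrt 2)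
        = ennreal (1 / 2 * (real n ^ 3 * (K / real m ^ 3 * r)) + (1 + 2 * sqrt 2))"
      by (rule ennreal_plus[symmetric]) (use r in auto)
    ultimately show ?thesis by simp
  qed
  also have "1 / 2 * (real n ^ 3 * (K / real m ^ 3 * r)) = real n ^ 3 * K * r / (2 * real m ^ 3)"
    by simp
  finally show "(\<integral>\<^sup>+\<omega>. ennreal (euclidean_TSPD \<alpha> ((\<lambda>i. X i \<omega>) ` ?I)) \<partial>M)
    \<le> ennreal (real n ^ 3 * K * r / (2 * real m ^ 3) + (1 + 2 * sqrt 2))" .
qed (use r in simp)

text \<open>With n = m + 3 and K about sqrt m / h, the factor (m + 3)^3 / m^3 tends to 1, K / sqrt n
  tends to 1 / h, and the additive constant vanishes after division by sqrt n.\<close>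

lemma limit_le_limit_cost:
  assumes \<alpha>: "1 \<le> \<alpha>" and h: "0 < h" and r: "limit_cost \<alpha> h \<le> ennreal r" "0 \<le> r"
    and lim: "(\<lambda>n. \<integral>\<omega>. euclidean_TSPD \<alpha> ((\<lambda>i. X i \<omega>) ` {..<n}) / sqrt (real n) \<partial>M) \<longlonglongrightarrow> \<beta>"
  shows "\<beta> \<le> r / (2 * h)"
proof (rule LIMSEQ_le[OF LIMSEQ_ignore_initial_segment[OF lim, of 3]])
  let ?B = "\<lambda>m::nat. (real (m + 3) ^ 3 * (sqrt m / h + 1) * r / (2 * real m ^ 3) + (1 + 2 * sqrt 2)) / sqrt (m + 3)"
  have "?B \<longlonglongrightarrow> inverse h * r / 2"
    using h by real_asymp
  then show "?B \<longlonglongrightarrow> r / (2 * h)"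
    using h by (simp add: field_simps)
  have "(\<integral>\<omega>. euclidean_TSPD \<alpha> ((\<lambda>i. X i \<omega>) ` {..<m + 3}) / sqrt (real (m + 3)) \<partial>M) \<le> ?B m" if "1 \<le> m" for m
  proof -
    \<comment> \<open>Rounded up, because the estimate needs \<open>sqrt m / K \<le> h\<close>; the
      excess of at most one strip is negligible against sqrt m.\<close>
    define K where "K = nat \<lceil>sqrt m / h\<rceil>"
    have pos: "0 < sqrt m / h"
      using that h by simp
    then have "sqrt m / h \<le> K" "K \<le> sqrt m / h + 1"
      unfolding K_def by linarith+
    moreover from this have "0 < K" "sqrt m \<le> h * K"
      using pos h by (auto simp: divide_le_eq mult.commute intro: ccontr)
    ultimately have K: "0 < K" "sqrt m / K \<le> h" "K \<le> sqrt m / h + 1"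
      by (auto simp: divide_le_eq)
    have "(\<integral>\<omega>. euclidean_TSPD \<alpha> ((\<lambda>i. X i \<omega>) ` {..<m + 3}) \<partial>M)
        \<le> real (m + 3) ^ 3 * K * r / (2 * real m ^ 3) + (1 + 2 * sqrt 2)"
      using that by (intro expectation_TSPD_le[OF K(1) _ _ K(2) \<alpha> r]) auto
    also have "\<dots> \<le> real (m + 3) ^ 3 * (sqrt m / h + 1) * r / (2 * real m ^ 3) + (1 + 2 * sqrt 2)"
      using K r by (intro add_right_mono divide_right_mono mult_right_mono mult_left_mono) auto
    finally show ?thesis
      by (simp add: divide_right_mono)
  qed
  then show "\<exists>N. \<forall>m\<ge>N. (\<integral>\<omega>. euclidean_TSPD \<alpha> ((\<lambda>i. X i \<omega>) ` {..<m + 3}) / sqrt (real (m + 3)) \<partial>M) \<le> ?B m"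
    by blast
qed

end


subsection \<open>Moments of a ring between exponential gaps\<close>

locale ring_variables = prob_space N for N :: "'b measure" +
  fixes Z1 Z2 U0 U1 U2 :: "'b \<Rightarrow> real"
  assumes indep: "indep_vars (\<lambda>_. borel) (\<lambda>i. [Z1, Z2, U0, U1, U2] ! i) {..<5}"
    and exponential: "\<forall>Z\<in>{Z1, Z2}. distributed N lborel Z (exponential_density 1)"
    and uniform: "\<forall>U\<in>{U0, U1, U2}. distr N borel U = unit_uniform"
begin

lemma rv [measurable]: "Z1 \<in> borel_measurable N" "Z2 \<in> borel_measurable N"
  "U0 \<in> borel_measurable N" "U1 \<in> borel_measurable N" "U2 \<in> borel_measurable N"
proof -
  have *: "[Z1, Z2, U0, U1, U2] ! i \<in> borel_measurable N" if "i < 5" for i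
    using indep that by (auto simp: indep_vars_def)
  show "Z1 \<in> borel_measurable N" "Z2 \<in> borel_measurable N"
    "U0 \<in> borel_measurable N" "U1 \<in> borel_measurable N" "U2 \<in> borel_measurable N"
    using *[of 0] *[of 1] *[of 2] *[of 3] *[of 4] by (simp_all add: numeral_eq_Suc)
qed

lemma indep_pairs:
  "indep_var borel Z1 borel Z2" "indep_var borel U0 borel U1"
  "indep_var borel U1 borel U2" "indep_var borel U0 borel U2"
  using indep_var_of_indep_vars[OF indep, of 0 1] indep_var_of_indep_vars[OF indep, of 2 3]
    indep_var_of_indep_vars[OF indep, of 3 4] indep_var_of_indep_vars[OF indep, of 2 4]
  by (simp_all add: numeral_eq_Suc)

lemma distr_exponential: "distr N borel Z1 = exp_law" "distr N borel Z2 = exp_law"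
proof -
  have "distr N borel Z = exp_law" if "Z \<in> {Z1, Z2}" for Z
  proof -
    have "distr N borel Z = distr N lborel Z"
      by (rule distr_cong) simp_all
    then show ?thesis
      using exponential that distributed_distr_eq_density by fastforce
  qed
  then show "distr N borel Z1 = exp_law" "distr N borel Z2 = exp_law" by simp_all
qed

definition ring_length :: "real \<Rightarrow> real \<Rightarrow> 'b \<Rightarrow> real" where
  "ring_length \<alpha> h \<omega> = gap_cost \<alpha> (edge_length h) (Z1 \<omega>) (Z2 \<omega>) (U0 \<omega>) (U1 \<omega>) (U2 \<omega>)"

lemma measurable_ring_length [measurable]: "ring_length \<alpha> h \<in> borel_measurable N"
  unfolding ring_length_def by measurable

text \<open>Independence turns the joint law of the five variables into a product, which is then
  integrated one coordinate at a time.\<close>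

lemma nn_integral_ring_length: "(\<integral>\<^sup>+\<omega>. ennreal (ring_length \<alpha> h \<omega>) \<partial>N) = limit_cost \<alpha> h"
proof -
  let ?V = "\<lambda>i. [Z1, Z2, U0, U1, U2] ! i"
  define L where "L = (\<lambda>i::nat. if i < 2 then exp_law else unit_uniform)"
  have sets_L [simp]: "sets (L i) = sets borel" for i
    by (simp add: L_def)
  have space_L [simp]: "space (L i) = UNIV" for i
    using sets_eq_imp_space_eq[OF sets_L] by simp
  interpret product_sigma_finite L
    using prob_space_exp_law prob_space_unit_uniform
    by (simp add: product_sigma_finite_def L_def prob_space_imp_sigma_finite)
  \<comment> \<open>The order of insertion fixes the order of integration: the positions 2, 0, 3, 1,
    4 of the list are U0, Z1, U1, Z2, U2, as in \<open>limit_cost\<close>.\<close>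
  have eq: "{..<5} = insert 2 (insert 0 (insert 3 (insert (Suc 0) (insert (4::nat) {}))))"
    by auto
  have cases: "i = 0 \<or> i = 1 \<or> i = 2 \<or> i = 3 \<or> i = 4" if "i \<in> {..<5}" for i :: nat
    using that by auto
  have law: "distr N borel (?V i) = L i" if "i \<in> {..<5}" for i
    using cases[OF that] distr_exponential uniform
    by (elim disjE) (simp_all add: L_def numeral_eq_Suc)
  have V: "?V i \<in> borel_measurable N" if "i \<in> {..<5}" for i
    using cases[OF that] rv by (elim disjE) (simp_all add: numeral_eq_Suc)
  have joint: "distr N (PiM {..<5} (\<lambda>_. borel)) (\<lambda>\<omega>. \<lambda>i\<in>{..<5}. ?V i \<omega>) = PiM {..<5} L"
  proof -
    have "distr N (PiM {..<5} (\<lambda>_. borel)) (\<lambda>\<omega>. \<lambda>i\<in>{..<5}. ?V i \<omega>) = PiM {..<5} (\<lambda>i. distr N borel (?V i))"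
      by (rule indep_vars_iff_distr_eq_PiM'[THEN iffD1, OF _ V indep]) (auto simp: lessThan_empty_iff bot_nat_def)
    also have "\<dots> = PiM {..<5} L"
      by (rule PiM_cong[OF refl law])
    finally show ?thesis .
  qed
  let ?f = "\<lambda>y. ennreal (gap_cost \<alpha> (edge_length h) (y 0) (y (Suc 0)) (y 2) (y 3) (y 4))"
  have meas: "(\<lambda>y. y i) \<in> borel_measurable (PiM I L)" if "i \<in> I" for i I
    using measurable_component_singleton[OF that, of L] measurable_cong_sets[OF refl sets_L] by blast
  have "(\<integral>\<^sup>+\<omega>. ennreal (ring_length \<alpha> h \<omega>) \<partial>N) = (\<integral>\<^sup>+\<omega>. ?f (\<lambda>i\<in>{..<5}. ?V i \<omega>) \<partial>N)"
    by (simp add: ring_length_def numeral_eq_Suc)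
  also have "\<dots> = (\<integral>\<^sup>+y. ?f y \<partial>distr N (PiM {..<5} (\<lambda>_. borel)) (\<lambda>\<omega>. \<lambda>i\<in>{..<5}. ?V i \<omega>))"
    by (rule nn_integral_distr[symmetric], rule measurable_restrict, rule V)
       (auto intro!: measurable_gap_cost_edge_length measurable_compose[OF _ measurable_ennreal] measurable_component_singleton)
  also have "\<dots> = (\<integral>\<^sup>+y. ?f y \<partial>PiM (insert 2 (insert 0 (insert 3 (insert (Suc 0) (insert 4 {}))))) L)"
    unfolding joint unfolding eq ..
  also have "\<dots> = (\<integral>\<^sup>+u0. \<integral>\<^sup>+y. ?f (y(2 := u0)) \<partial>PiM (insert 0 (insert 3 (insert (Suc 0) (insert 4 {})))) L \<partial>L 2)"
    by (rule product_nn_integral_insert_rev)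
       (auto intro!: measurable_gap_cost_edge_length measurable_compose[OF _ measurable_ennreal] meas)
  also have "\<dots> = (\<integral>\<^sup>+u0. \<integral>\<^sup>+z1. \<integral>\<^sup>+y. ?f (y(0 := z1, 2 := u0)) \<partial>PiM (insert 3 (insert (Suc 0) (insert 4 {}))) L \<partial>L 0 \<partial>L 2)"
    by (rule nn_integral_cong, rule product_nn_integral_insert_rev)
       (auto intro!: measurable_gap_cost_edge_length measurable_compose[OF _ measurable_ennreal] meas)
  also have "\<dots> = (\<integral>\<^sup>+u0. \<integral>\<^sup>+z1. \<integral>\<^sup>+u1. \<integral>\<^sup>+y. ?f (y(3 := u1, 0 := z1, 2 := u0)) \<partial>PiM (insert (Suc 0) (insert 4 {})) L \<partial>L 3 \<partial>L 0 \<partial>L 2)"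
    by (intro nn_integral_cong, rule product_nn_integral_insert_rev)
       (auto intro!: measurable_gap_cost_edge_length measurable_compose[OF _ measurable_ennreal] meas)
  also have "\<dots> = (\<integral>\<^sup>+u0. \<integral>\<^sup>+z1. \<integral>\<^sup>+u1. \<integral>\<^sup>+z2. \<integral>\<^sup>+y. ?f (y(Suc 0 := z2, 3 := u1, 0 := z1, 2 := u0)) \<partial>PiM (insert 4 {}) L \<partial>L (Suc 0) \<partial>L 3 \<partial>L 0 \<partial>L 2)"
    by (intro nn_integral_cong, rule product_nn_integral_insert_rev)
       (auto intro!: measurable_gap_cost_edge_length measurable_compose[OF _ measurable_ennreal] meas)
  also have "\<dots> = (\<integral>\<^sup>+u0. \<integral>\<^sup>+z1. \<integral>\<^sup>+u1. \<integral>\<^sup>+z2. \<integral>\<^sup>+u2. \<integral>\<^sup>+y. ?f (y(4 := u2, Suc 0 := z2, 3 := u1, 0 := z1, 2 := u0)) \<partial>PiM {} L \<partial>L 4 \<partial>L (Suc 0) \<partial>L 3 \<partial>L 0 \<partial>L 2)"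
    by (intro nn_integral_cong, rule product_nn_integral_insert_rev)
       (auto intro!: measurable_gap_cost_edge_length measurable_compose[OF _ measurable_ennreal] meas)
  also have "\<dots> = limit_cost \<alpha> h"
    by (simp add: PiM_empty nn_integral_count_space_finite limit_cost_def L_def)
  finally show ?thesis .
qed

section \<open>First and second moments of the ring length\<close>

lemma exponential_moment:
  assumes "Z \<in> {Z1, Z2}"
  shows "has_bochner_integral N (\<lambda>\<omega>. Z \<omega> ^ i) (fact i)"
  using has_bochner_integral_erlang_ith_moment[of 1 Z 0 i] exponential assms by auto

lemma uniform_moment:
  assumes "U \<in> {U0, U1, U2}"
  shows "has_bochner_integral N (\<lambda>\<omega>. U \<omega> ^ i) (1 / (i + 1))"
proof (rule has_bochner_integral_nn_integral)
  have U [measurable]: "U \<in> borel_measurable N" and d: "distr N borel U = unit_uniform"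
    using assms rv uniform by auto
  show "(\<lambda>\<omega>. U \<omega> ^ i) \<in> borel_measurable N" by measurable
  have "AE x in distr N borel U. 0 \<le> x ^ i"
    unfolding d using AE_unit_uniform by eventually_elim simp
  then show "AE \<omega> in N. 0 \<le> U \<omega> ^ i"
    by (subst (asm) AE_distr_iff) auto
  have "(\<integral>\<^sup>+\<omega>. ennreal (U \<omega> ^ i) \<partial>N) = (\<integral>\<^sup>+x. ennreal (x ^ i) \<partial>unit_uniform)"
    by (subst d[symmetric], subst nn_integral_distr) auto
  also have "\<dots> = (\<integral>\<^sup>+x. ennreal (x ^ i) * indicator {0..1} x \<partial>lborel)"
    by (rule nn_integral_unit_uniform) measurable
  also have "\<dots> = ennreal ((\<lambda>x. x ^ Suc i / Suc i) 1 - (\<lambda>x. x ^ Suc i / Suc i) (0 :: real))"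
    by (rule nn_integral_FTC_Icc)
       (auto intro!: derivative_eq_intros simp: field_simps simp del: power_Suc of_nat_Suc)
  also have "\<dots> = ennreal (1 / (i + 1))"
    by (simp add: add.commute)
  finally show "(\<integral>\<^sup>+\<omega>. ennreal (U \<omega> ^ i) \<partial>N) = ennreal (1 / (i + 1))" .
qed simp

lemma indep_product_moment:
  assumes "indep_var borel X borel Y" "has_bochner_integral N X a" "has_bochner_integral N Y b"
  shows "has_bochner_integral N (\<lambda>\<omega>. X \<omega> * Y \<omega>) (a * (b :: real))"
  using indep_var_integrable[OF assms(1)] indep_var_lebesgue_integral[OF assms(1)] assms(2,3)
  by (simp add: has_bochner_integral_iff)

lemma exponential_sum_square: "has_bochner_integral N (\<lambda>\<omega>. (Z1 \<omega> + Z2 \<omega>)\<^sup>2) 6"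
proof -
  have "has_bochner_integral N (\<lambda>\<omega>. Z1 \<omega> ^ 2 + Z2 \<omega> ^ 2 + 2 * (Z1 \<omega> * Z2 \<omega>)) (fact 2 + fact 2 + 2 * (1 * 1))"
    using exponential_moment[of Z1 1] exponential_moment[of Z2 1]
    by (intro has_bochner_integral_add has_bochner_integral_mult_right exponential_moment
        indep_product_moment indep_pairs) auto
  then show ?thesis
    by (simp add: power2_sum mult.assoc)
qed

lemma uniform_diff_square:
  assumes "indep_var borel U borel U'" "U \<in> {U0, U1, U2}" "U' \<in> {U0, U1, U2}"
  shows "has_bochner_integral N (\<lambda>\<omega>. (U \<omega> - U' \<omega>)\<^sup>2) (1 / 6)"
proof -
  have mean: "has_bochner_integral N U (1 / 2)" "has_bochner_integral N U' (1 / 2)"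
    and square: "has_bochner_integral N (\<lambda>\<omega>. U \<omega> ^ 2) (1 / 3)" "has_bochner_integral N (\<lambda>\<omega>. U' \<omega> ^ 2) (1 / 3)"
    using uniform_moment[OF assms(2), of 1] uniform_moment[OF assms(3), of 1]
      uniform_moment[OF assms(2), of 2] uniform_moment[OF assms(3), of 2] by simp_all
  have "has_bochner_integral N (\<lambda>\<omega>. U \<omega> ^ 2 + U' \<omega> ^ 2 - 2 * (U \<omega> * U' \<omega>)) (1 / 3 + 1 / 3 - 2 * (1 / 2 * (1 / 2)))"
    by (intro has_bochner_integral_add has_bochner_integral_diff has_bochner_integral_mult_right
        indep_product_moment mean square assms(1))
  then show ?thesis
    by (simp add: power2_diff mult.assoc)
qed

text \<open>A polynomial in the five variables, so first and second moments determine its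
  expectation. It also serves as the integrable majorant of the squared ring length.\<close>

definition ring_length_square_bound :: "real \<Rightarrow> real \<Rightarrow> 'b \<Rightarrow> real" where
  "ring_length_square_bound \<alpha> h \<omega> = (Z1 \<omega> + Z2 \<omega>)\<^sup>2 + h ^ 4 * (U0 \<omega> - U2 \<omega>)\<^sup>2
    + 2 / \<alpha>\<^sup>2 * (Z1 \<omega> ^ 2 + Z2 \<omega> ^ 2 + h ^ 4 * ((U0 \<omega> - U1 \<omega>)\<^sup>2 + (U1 \<omega> - U2 \<omega>)\<^sup>2))"

lemma ring_length_square_le: "(ring_length \<alpha> h \<omega>)\<^sup>2 \<le> ring_length_square_bound \<alpha> h \<omega>"
proof -
  have max_le: "(max a b)\<^sup>2 \<le> a\<^sup>2 + b\<^sup>2" for a b :: real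
    by (simp add: max_def)
  define x where "x = edge_length h (Z1 \<omega>) (U0 \<omega> - U1 \<omega>)"
  define y where "y = edge_length h (Z2 \<omega>) (U1 \<omega> - U2 \<omega>)"
  have sq: "(edge_length h z v)\<^sup>2 = z\<^sup>2 + h ^ 4 * v\<^sup>2" for z v
    by (simp add: edge_length_def)
  have "(x + y)\<^sup>2 \<le> 2 * (x\<^sup>2 + y\<^sup>2)"
    using zero_le_power2[of "x - y"] by (simp add: power2_diff power2_sum)
  then have "1 / \<alpha>\<^sup>2 * (x + y)\<^sup>2 \<le> 1 / \<alpha>\<^sup>2 * (2 * (x\<^sup>2 + y\<^sup>2))"
    by (rule mult_left_mono) simp
  then have "(1 / \<alpha> * (x + y))\<^sup>2 \<le> 2 / \<alpha>\<^sup>2 * (x\<^sup>2 + y\<^sup>2)"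
    by (simp add: power_mult_distrib power_divide)
  moreover have "(ring_length \<alpha> h \<omega>)\<^sup>2 \<le> (edge_length h (Z1 \<omega> + Z2 \<omega>) (U0 \<omega> - U2 \<omega>))\<^sup>2 + (1 / \<alpha> * (x + y))\<^sup>2"
    unfolding ring_length_def gap_cost_def x_def y_def by (rule max_le)
  moreover have "x\<^sup>2 + y\<^sup>2 = Z1 \<omega> ^ 2 + Z2 \<omega> ^ 2 + h ^ 4 * ((U0 \<omega> - U1 \<omega>)\<^sup>2 + (U1 \<omega> - U2 \<omega>)\<^sup>2)"
    unfolding x_def y_def sq by (simp add: algebra_simps)
  ultimately show ?thesis
    unfolding ring_length_square_bound_def sq by simp
qed

text \<open>The constant part is 6 + 8 / \<open>\<alpha>\<^sup>2\<close> and the coefficient of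
  \<open>h ^ 4\<close> is 1 / 6 + 2 / \<open>(3 * \<alpha>\<^sup>2)\<close>. With 6 and 1 / 6
  factored out, their product is visibly the radicand of the closed form.\<close>

lemma ring_length_square_bound_moment:
  "has_bochner_integral N (ring_length_square_bound \<alpha> h)
     (6 * (1 + 4 / (3 * \<alpha>\<^sup>2)) + (1 + 4 / \<alpha>\<^sup>2) / 6 * h ^ 4)"
proof -
  have "has_bochner_integral N (ring_length_square_bound \<alpha> h)
    (6 + h ^ 4 * (1 / 6) + 2 / \<alpha>\<^sup>2 * (fact 2 + fact 2 + h ^ 4 * (1 / 6 + 1 / 6)))"
    unfolding ring_length_square_bound_def[abs_def]
    by (intro has_bochner_integral_add has_bochner_integral_mult_right exponential_moment
        exponential_sum_square uniform_diff_square indep_pairs) auto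
  moreover have "6 + h ^ 4 * (1 / 6) + 2 / \<alpha>\<^sup>2 * (fact 2 + fact 2 + h ^ 4 * (1 / 6 + 1 / 6))
    = 6 * (1 + 4 / (3 * \<alpha>\<^sup>2)) + (1 + 4 / \<alpha>\<^sup>2) / 6 * h ^ 4"
    \<comment> \<open>At zero both sides agree because division by zero yields zero.\<close>
    by (cases "\<alpha> = 0") (simp_all add: field_simps)
  ultimately show ?thesis by (simp only:)
qed

lemma integrable_ring_length_square: "integrable N (\<lambda>\<omega>. (ring_length \<alpha> h \<omega>)\<^sup>2)"
proof (rule Bochner_Integration.integrable_bound)
  show "integrable N (ring_length_square_bound \<alpha> h)"
    using ring_length_square_bound_moment by (auto simp: has_bochner_integral_iff)
  show "AE \<omega> in N. norm ((ring_length \<alpha> h \<omega>)\<^sup>2) \<le> norm (ring_length_square_bound \<alpha> h \<omega>)"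
    using ring_length_square_le[of \<alpha> h] by (auto intro: order.trans[OF _ abs_ge_self])
qed measurable

lemma integrable_ring_length: "integrable N (ring_length \<alpha> h)"
  by (rule square_integrable_imp_integrable[OF _ integrable_ring_length_square]) measurable

lemma limit_cost_eq: "limit_cost \<alpha> h = ennreal (expectation (ring_length \<alpha> h))"
  unfolding nn_integral_ring_length[symmetric]
  by (rule nn_integral_eq_integral[OF integrable_ring_length])
     (simp add: ring_length_def gap_cost_edge_length_nonneg)

lemma expectation_ring_length_nonneg: "0 \<le> expectation (ring_length \<alpha> h)"
  by (rule integral_nonneg_AE) (simp add: ring_length_def gap_cost_edge_length_nonneg)

text \<open>Jensen's inequality for the square, in the form that the variance is
  nonnegative.\<close>

lemma expectation_ring_length_le:
  "expectation (ring_length \<alpha> h) \<le> sqrt (6 * (1 + 4 / (3 * \<alpha>\<^sup>2)) + (1 + 4 / \<alpha>\<^sup>2) / 6 * h ^ 4)"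
proof (rule real_le_rsqrt)
  have "0 \<le> variance (ring_length \<alpha> h)"
    by (rule variance_positive)
  then have "(expectation (ring_length \<alpha> h))\<^sup>2 \<le> expectation (\<lambda>\<omega>. (ring_length \<alpha> h \<omega>)\<^sup>2)"
    by (simp add: variance_eq[OF integrable_ring_length integrable_ring_length_square])
  also have "\<dots> \<le> expectation (ring_length_square_bound \<alpha> h)"
    using ring_length_square_bound_moment
    by (intro integral_mono integrable_ring_length_square ring_length_square_le) (auto simp: has_bochner_integral_iff)
  also have "\<dots> = 6 * (1 + 4 / (3 * \<alpha>\<^sup>2)) + (1 + 4 / \<alpha>\<^sup>2) / 6 * h ^ 4"
    using ring_length_square_bound_moment by (rule has_bochner_integral_integral_eq)
  finally show "(expectation (ring_length \<alpha> h))\<^sup>2 \<le> 6 * (1 + 4 / (3 * \<alpha>\<^sup>2)) + (1 + 4 / \<alpha>\<^sup>2) / 6 * h ^ 4" .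
qed

end

text \<open>The closed form mentions no random variables, and a given type \<open>'b\<close> may be
  too small to carry any with these laws. The coordinates of a product space provide a model on a
  fixed type.\<close>

lemma ring_variables_exist:
  "\<exists>(N :: (nat \<Rightarrow> real) measure) Z1 Z2 U0 U1 U2. ring_variables N Z1 Z2 U0 U1 U2"
proof -
  define L where "L = (\<lambda>i::nat. if i < 2 then exp_law else unit_uniform)"
  define N where "N = PiM {..<5} L"
  let ?V = "\<lambda>i::nat. \<lambda>\<omega>::nat \<Rightarrow> real. \<omega> i"
  have sets_L [simp]: "sets (L i) = sets borel" for i
    by (simp add: L_def)
  have prob_L: "prob_space (L i)" for i
    using prob_space_exp_law prob_space_unit_uniform by (simp add: L_def)
  interpret prob_space N
    unfolding N_def using prob_L by (rule prob_space_PiM)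
  have meas: "?V i \<in> borel_measurable N" if "i \<in> {..<5}" for i
    using measurable_component_singleton[OF that, of L] measurable_cong_sets[OF refl sets_L]
    unfolding N_def by blast
  have law: "distr N borel (?V i) = L i" if "i \<in> {..<5}" for i
  proof -
    have "distr N borel (?V i) = distr N (L i) (?V i)"
      by (rule distr_cong) simp_all
    also have "\<dots> = L i"
      unfolding N_def using prob_L that by (rule distr_PiM_component)
    finally show ?thesis .
  qed
  have "distr N (PiM {..<5} (\<lambda>_. borel)) (\<lambda>\<omega>. \<lambda>i\<in>{..<5}. ?V i \<omega>) = distr N N (\<lambda>\<omega>. \<omega>)"
  proof (rule distr_cong)
    show "sets (PiM {..<5} (\<lambda>_. borel)) = sets N"
      unfolding N_def by (rule sets_PiM_cong) simp_all
    show "(\<lambda>i\<in>{..<5}. ?V i \<omega>) = \<omega>" if "\<omega> \<in> space N" for \<omega>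
      using that by (auto simp: N_def space_PiM PiE_def extensional_restrict)
  qed simp
  also have "\<dots> = PiM {..<5} (\<lambda>i. distr N borel (?V i))"
  proof -
    have "PiM {..<5} (\<lambda>i. distr N borel (?V i)) = PiM {..<5} L"
      by (rule PiM_cong[OF refl law])
    then show ?thesis
      by (simp only: distr_id2 N_def[symmetric])
  qed
  finally have ind: "indep_vars (\<lambda>_. borel) ?V {..<5}"
    by (intro indep_vars_iff_distr_eq_PiM'[THEN iffD2] meas) (auto simp: lessThan_empty_iff bot_nat_def)
  have nth: "[?V 0, ?V 1, ?V 2, ?V 3, ?V 4] ! i = ?V i" if "i \<in> {..<5}" for i
  proof -
    have "i = 0 \<or> i = 1 \<or> i = 2 \<or> i = 3 \<or> i = 4" using that by auto
    then show ?thesis by (auto simp: numeral_eq_Suc)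
  qed
  have "indep_vars (\<lambda>_. borel) (\<lambda>i. [?V 0, ?V 1, ?V 2, ?V 3, ?V 4] ! i) {..<5}"
    using ind by (subst indep_vars_cong[OF refl nth refl])
  moreover have "distributed N lborel (?V i) (exponential_density 1)" if "i \<in> {0, 1}" for i
  proof -
    have "distr N lborel (?V i) = distr N borel (?V i)"
      by (rule distr_cong) simp_all
    moreover have "?V i \<in> borel_measurable N"
      using that by (intro meas) auto
    ultimately show ?thesis
      using that law[of i] by (auto simp: distributed_def L_def)
  qed
  moreover have "distr N borel (?V i) = unit_uniform" if "i \<in> {2, 3, 4}" for i
    using that law[of i] by (auto simp: L_def)
  ultimately have "ring_variables N (?V 0) (?V 1) (?V 2) (?V 3) (?V 4)"
    by unfold_locales simp_all
  then show ?thesis by blast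
qed

theorem mainTheorem5:
  fixes M :: "'a measure" and X :: "nat \<Rightarrow> 'a \<Rightarrow> real ^ 2" and \<alpha> \<beta> :: real
  assumes "\<alpha> \<ge> 1"
    and "prob_space M"
    and "prob_space.indep_vars M (\<lambda>_. borel) X UNIV"
    and "\<And>i. distr M borel (X i) = uniform_measure lborel (cbox 0 1)"
    and "AE \<omega> in M. (\<lambda>n. euclidean_TSPD \<alpha> ((\<lambda>i. X i \<omega>) ` {..<n}) / sqrt (real n)) \<longlonglongrightarrow> \<beta>"
    and "(\<lambda>n. \<integral>\<omega>. euclidean_TSPD \<alpha> ((\<lambda>i. X i \<omega>) ` {..<n}) / sqrt (real n) \<partial>M) \<longlonglongrightarrow> \<beta>"
  shows "(\<forall>h::real. h > 0 \<longrightarrow> (\<forall>(N :: 'b measure) Z1 Z2 U0 U1 U2.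
            prob_space N \<longrightarrow>
            prob_space.indep_vars N (\<lambda>_. borel) (\<lambda>i. [Z1, Z2, U0, U1, U2] ! i) {..<5} \<longrightarrow>
            (\<forall>Z\<in>{Z1, Z2}. distributed N lborel Z (exponential_density 1)) \<longrightarrow>
            (\<forall>U\<in>{U0, U1, U2}. distr N borel U = uniform_measure lborel {0..1}) \<longrightarrow>
            \<beta> \<le> 1 / (2 * h) * (\<integral>\<omega>.
              (let L01 = sqrt ((Z1 \<omega>)\<^sup>2 + h ^ 4 * (U0 \<omega> - U1 \<omega>)\<^sup>2);
                   L12 = sqrt ((Z2 \<omega>)\<^sup>2 + h ^ 4 * (U1 \<omega> - U2 \<omega>)\<^sup>2);
                   L02 = sqrt ((Z1 \<omega> + Z2 \<omega>)\<^sup>2 + h ^ 4 * (U0 \<omega> - U2 \<omega>)\<^sup>2)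
               in max L02 (1 / \<alpha> * (L01 + L12))) \<partial>N)))
       \<and> \<beta> \<le> 1 / sqrt 2 * ((1 + 4 / (3 * \<alpha>\<^sup>2)) * (1 + 4 / \<alpha>\<^sup>2)) powr (1 / 4)"
proof -
  interpret P: uniform_points M X
    using assms(2-4) by (simp add: uniform_points_def uniform_points_axioms_def)
  have bound: "\<beta> \<le> r / (2 * h)" if "0 < h" "limit_cost \<alpha> h \<le> ennreal r" "0 \<le> r" for h r
    using P.limit_le_limit_cost[OF assms(1) that assms(6)] .
  show ?thesis
  proof (intro conjI allI impI)
    fix h :: real and N :: "'b measure" and Z1 Z2 U0 U1 U2
    assume h: "0 < h" and N: "prob_space N"
      "prob_space.indep_vars N (\<lambda>_. borel) (\<lambda>i. [Z1, Z2, U0, U1, U2] ! i) {..<5}"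
      "\<forall>Z\<in>{Z1, Z2}. distributed N lborel Z (exponential_density 1)"
      "\<forall>U\<in>{U0, U1, U2}. distr N borel U = unit_uniform"
    interpret ring_variables N Z1 Z2 U0 U1 U2
      using N by (simp only: ring_variables_def ring_variables_axioms_def)
    have "\<beta> \<le> expectation (ring_length \<alpha> h) / (2 * h)"
      using expectation_ring_length_nonneg by (intro bound h) (simp_all add: limit_cost_eq)
    then show "\<beta> \<le> 1 / (2 * h) * (\<integral>\<omega>.
              (let L01 = sqrt ((Z1 \<omega>)\<^sup>2 + h ^ 4 * (U0 \<omega> - U1 \<omega>)\<^sup>2);
                   L12 = sqrt ((Z2 \<omega>)\<^sup>2 + h ^ 4 * (U1 \<omega> - U2 \<omega>)\<^sup>2);
                   L02 = sqrt ((Z1 \<omega> + Z2 \<omega>)\<^sup>2 + h ^ 4 * (U0 \<omega> - U2 \<omega>)\<^sup>2)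
               in max L02 (1 / \<alpha> * (L01 + L12))) \<partial>N)"
      by (simp add: ring_length_def[abs_def] gap_cost_def edge_length_def Let_def)
  next
    \<comment> \<open>\<open>A\<close> and \<open>B\<close> are the constant part and the
      coefficient of \<open>h ^ 4\<close> in the second moment bound; their fourth roots
      \<open>a\<close> and \<open>b\<close> keep the computation polynomial.\<close>
    define A where "A = 6 * (1 + 4 / (3 * \<alpha>\<^sup>2))"
    define B where "B = (1 + 4 / \<alpha>\<^sup>2) / 6"
    have pos: "0 < A" "0 < B"
      by (auto simp: A_def B_def intro!: mult_pos_pos add_pos_nonneg)
    define a where "a = A powr (1 / 4)"
    define b where "b = B powr (1 / 4)"
    have ab: "0 < a" "0 < b" "a ^ 4 = A" "b ^ 4 = B"
      using pos by (simp_all add: a_def b_def powr_power)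
    \<comment> \<open>The square of the resulting bound is (A / h^2 + B * h^2) / 4. By the
      inequality of arithmetic and geometric means it is least where both summands agree, so that A
      + B * h^4 becomes 2 * A.\<close>
    define h where "h = a / b"
    have "0 < h" using ab by (simp add: h_def)
    obtain N :: "(nat \<Rightarrow> real) measure" and Z1 Z2 U0 U1 U2 where "ring_variables N Z1 Z2 U0 U1 U2"
      using ring_variables_exist by blast
    then interpret ring_variables N Z1 Z2 U0 U1 U2 .
    have "\<beta> \<le> sqrt (A + B * h ^ 4) / (2 * h)"
      using expectation_ring_length_le[of \<alpha> h, folded A_def B_def] pos \<open>0 < h\<close>
      by (intro bound \<open>0 < h\<close>) (simp_all add: limit_cost_eq ennreal_leI)
    also have "A + B * h ^ 4 = 2 * a ^ 4"
      using ab by (simp add: h_def power_divide flip: ab(3,4))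
    also have "sqrt (2 * a ^ 4) = sqrt 2 * a\<^sup>2"
  proof -
    have "sqrt (a ^ 4) = a\<^sup>2"
      by (rule real_sqrt_unique) simp_all
    then show ?thesis by (simp only: real_sqrt_mult)
  qed
    also have "sqrt 2 * a\<^sup>2 / (2 * h) = sqrt 2 / 2 * (a * b)"
      using ab by (simp add: h_def power2_eq_square)
    also have "sqrt 2 / 2 = 1 / sqrt (2 :: real)"
      by (simp add: real_div_sqrt field_simps)
    also have "a * b = (A * B) powr (1 / 4)"
      using pos by (simp add: a_def b_def powr_mult)
    also have "A * B = (1 + 4 / (3 * \<alpha>\<^sup>2)) * (1 + 4 / \<alpha>\<^sup>2)"
      by (simp add: A_def B_def)
    finally show "\<beta> \<le> 1 / sqrt 2 * ((1 + 4 / (3 * \<alpha>\<^sup>2)) * (1 + 4 / \<alpha>\<^sup>2)) powr (1 / 4)" .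
  qed
qed

end
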